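(* For every $\varepsilon\in(0,1)$ there is a constant $C_\varepsilon<\infty$, depending only on $\varepsilon$, such that for all $n\ge2$ and all $1\le k\le n$, the $\varepsilon$-mixing time $t_{\mathrm{mix}}(\varepsilon)$ of the $\frac12$-lazy exclusion process on the complete graph with $n$ vertices and $k$ labelled particles satisfies $$\bigl|\,t_{\mathrm{mix}}(\varepsilon)-n\log k\,\bigr|\le C_\varepsilon\, n ;$$ that is, $t_{\mathrm{mix}}(\varepsilon)=n\log k+O_\varepsilon(n)$, where the constant in the error term depends on $\varepsilon$ but not on $k$.
   Context: The $\frac12$-lazy exclusion process with $k$ labelled particles on the complete graph $K_n$ is the discrete time Markov chain whose states are the placements of $k$ distinguishable particles on distinct vertices of $K_n$ (injective maps $\{1,\dots,k\}\to V(K_n)$). At each step, with probability $1/2$ nothing happens, and with probability $1/2$ one of the $\binom n2$ edges is chosen uniformly at random and the contents of its two endpoints (each endpoint being a particle or empty) are swapped. Equivalently, it is the $\frac12$-lazy interchange process (random transpositions) on $K_n$ in which only the locations of $k$ of the $n$ labelled particles are followed. The stationary distribution $\pi$ is uniform. Total variation distance: $\|\mu-\nu\|=\max_A|\mu(A)-\nu(A)|$. With $P^t$ the $t$-step transition matrix, $d(t)=\max_x\|P^t(x,\cdot)-\pi\|$ and $t_{\mathrm{mix}}(\varepsilon)=\inf\{t>0:d(t)<\varepsilon\}$. *)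

theory Defs
  imports "HOL-Probability.Probability" "HOL-Combinatorics.Transposition"
begin

text \<open>
  The vertices of the complete graph are \<open>{1..n}\<close> and the particles are \<open>{1..k}\<close>. A placement is a
  function taking the value \<open>undefined\<close> outside \<open>{1..k}\<close>, so that it is determined by the
  positions of the particles.
\<close>

definition placements :: "nat \<Rightarrow> nat \<Rightarrow> (nat \<Rightarrow> nat) set" where
  "placements n k = {x \<in> {1..k} \<rightarrow>\<^sub>E {1..n}. inj_on x {1..k}}"

text \<open>Each undirected edge is represented once, as a pair with increasing endpoints.\<close>

definition complete_edges :: "nat \<Rightarrow> (nat \<times> nat) set" where
  "complete_edges n = {(u, v). u \<in> {1..n} \<and> v \<in> {1..n} \<and> u < v}"

definition swap_contents :: "nat \<Rightarrow> nat \<times> nat \<Rightarrow> (nat \<Rightarrow> nat) \<Rightarrow> (nat \<Rightarrow> nat)" where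
  "swap_contents k e x = (\<lambda>i\<in>{1..k}. Transposition.transpose (fst e) (snd e) (x i))"

definition lazy_exclusion_step :: "nat \<Rightarrow> nat \<Rightarrow> (nat \<Rightarrow> nat) \<Rightarrow> (nat \<Rightarrow> nat) pmf" where
  "lazy_exclusion_step n k x =
     bind_pmf (bernoulli_pmf (1/2))
       (\<lambda>idle. if idle then return_pmf x
               else map_pmf (\<lambda>e. swap_contents k e x) (pmf_of_set (complete_edges n)))"

primrec steps :: "('a \<Rightarrow> 'a pmf) \<Rightarrow> nat \<Rightarrow> 'a \<Rightarrow> 'a pmf" where
  "steps K 0 x = return_pmf x"
| "steps K (Suc t) x = bind_pmf (steps K t x) K"

definition total_variation :: "'a pmf \<Rightarrow> 'a pmf \<Rightarrow> real" where
  "total_variation \<mu> \<nu> = (SUP A. \<bar>measure_pmf.prob \<mu> A - measure_pmf.prob \<nu> A\<bar>)"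

definition exclusion_distance :: "nat \<Rightarrow> nat \<Rightarrow> nat \<Rightarrow> real" where
  "exclusion_distance n k t =
     (MAX x\<in>placements n k.
        total_variation (steps (lazy_exclusion_step n k) t x) (pmf_of_set (placements n k)))"

text \<open>
  The value is an extended real, so that the infimum is \<open>\<infinity>\<close> if the distance never drops below
  \<open>\<epsilon>\<close>; a finite bound on the mixing time therefore includes the claim that it does.
\<close>

definition exclusion_mixing_time :: "nat \<Rightarrow> nat \<Rightarrow> real \<Rightarrow> ereal" where
  "exclusion_mixing_time n k \<epsilon> =
     (INF t\<in>{t. 0 < t \<and> exclusion_distance n k t < \<epsilon>}. ereal (real t))"

end

theory Submission
  imports Defs "HOL-Combinatorics.Permutations"
begin

text \<open>
  Everything is read off from the lazy transposition walk on the permutations of \<open>W = {1..n}\<close>,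
  acting on functions of a permutation: a placement is a permutation restricted to \<open>{1..k}\<close>, so an
  event for \<open>k\<close> particles is a function invariant under right multiplication by the permutations
  of the remaining \<open>n - k\<close> sites.

  Upper bound for \<open>2 k \<le> n\<close>. Averaging over the permutations of a set \<open>A\<close> of marked particles,
  initially the empty sites, is compatible with the walk: one step turns the average over \<open>A\<close> into
  a mixture of translates of it and of averages over \<open>A \<union> {b}\<close>. So each unmarked particle gets
  marked at rate \<open>(|A| + 1) / (n (n - 1))\<close>, a coupon collector problem that ends at \<open>n ln k + O(n)\<close>.

  Upper bound for \<open>2 k > n\<close>. It suffices to mix all \<open>n\<close> particles in square mean, as in the theorem
  of Diaconis and Shahshahani, but characters of the symmetric group are not needed. If \<open>m\<close> is the
  largest size of a set \<open>A\<close> such that the average of an eigenfunction over \<open>A\<close> is not zero, then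
  the average \<open>g\<close> satisfies \<open>\<Sum>\<^sub>a g (x \<circ> (a b)) = - g x\<close> for \<open>b\<close> outside \<open>A\<close> (the sum is over \<open>a\<close>
  in \<open>A\<close>), which bounds the eigenvalue in terms of \<open>m\<close>. The multiplicities are controlled by the
  operator inequality \<open>P^(2 t) \<le> \<Sum>\<^sub>A \<beta>(|A|)^(2 t) E\<^sub>A\<close> between the walk \<open>P\<close> and the averages \<open>E\<^sub>A\<close>.

  Lower bound. At time \<open>n ln k - C n\<close> about \<open>exp C\<close> particles have not been touched, by a second
  moment computation, while a uniform placement has at most one fixed particle on average.
\<close>

section \<open>Self-adjoint operators on functions on a finite set\<close>

definition ip :: "'b set \<Rightarrow> ('b \<Rightarrow> real) \<Rightarrow> ('b \<Rightarrow> real) \<Rightarrow> real" where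
  "ip G f g = (\<Sum>x\<in>G. f x * g x)"

text \<open>Functions on \<open>G\<close> are encoded as total functions vanishing off
  \<open>G\<close>, so that equality of functions is equality on \<open>G\<close>.\<close>

definition supported :: "'b set \<Rightarrow> ('b \<Rightarrow> real) \<Rightarrow> bool" where
  "supported G f \<longleftrightarrow> (\<forall>x. x \<notin> G \<longrightarrow> f x = 0)"

definition linop :: "(('b \<Rightarrow> real) \<Rightarrow> ('b \<Rightarrow> real)) \<Rightarrow> bool" where
  "linop S \<longleftrightarrow> (\<forall>c f g. S (\<lambda>x. c * f x + g x) = (\<lambda>x. c * S f x + S g x))"

lemma linopD: "linop S \<Longrightarrow> S (\<lambda>x. c * f x + g x) = (\<lambda>x. c * S f x + S g x)"
  by (simp add: linop_def)

lemma linop_zero: assumes "linop S" shows "S (\<lambda>_. 0) = (\<lambda>_. 0)"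
  using linopD[OF assms, of 1 "\<lambda>_. 0" "\<lambda>_. 0"] by (auto simp: fun_eq_iff)

lemma linop_scale: assumes "linop S" shows "S (\<lambda>x. c * f x) = (\<lambda>x. c * S f x)"
  using linopD[OF assms, of c f "\<lambda>_. 0"] by (simp add: linop_zero[OF assms])

lemma linop_sum:
  assumes "linop S"
  shows "S (\<lambda>x. \<Sum>i\<in>I. c i * f i x) = (\<lambda>x. \<Sum>i\<in>I. c i * S (f i) x)"
proof (induction I rule: infinite_finite_induct)
  case (insert i I)
  have "S (\<lambda>x. \<Sum>i\<in>insert i I. c i * f i x) = S (\<lambda>x. c i * f i x + (\<Sum>i\<in>I. c i * f i x))"
    using insert by simp
  then show ?case using insert by (simp add: linopD[OF assms])
qed (simp_all add: linop_zero[OF assms])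

section \<open>Bilinearity and positivity of the inner product\<close>

lemma ip_commute: "ip G f g = ip G g f"
  by (simp add: ip_def mult.commute)

lemma ip_lin_left: "ip G (\<lambda>x. c * f x + g x) h = c * ip G f h + ip G g h"
  by (simp add: ip_def sum.distrib sum_distrib_left algebra_simps)

lemma ip_lin_right: "ip G h (\<lambda>x. c * f x + g x) = c * ip G h f + ip G h g"
  by (simp add: ip_def sum.distrib sum_distrib_left algebra_simps)

lemma ip_scale_left: "ip G (\<lambda>x. c * f x) h = c * ip G f h"
  by (simp add: ip_def sum_distrib_left algebra_simps)

lemma ip_scale_right: "ip G h (\<lambda>x. c * f x) = c * ip G h f"
  by (simp add: ip_def sum_distrib_left algebra_simps)

lemma ip_nonneg: "0 \<le> ip G f f"
  by (simp add: ip_def sum_nonneg)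

lemma ip_self_eq_0:
  assumes "finite G" "supported G f" "ip G f f = 0"
  shows "f = (\<lambda>_. 0)"
proof -
  have "\<forall>x\<in>G. f x * f x = 0"
    using assms(1,3) by (subst (asm) ip_def, subst (asm) sum_nonneg_eq_0_iff) auto
  then show ?thesis using assms(2) by (auto simp: supported_def fun_eq_iff)
qed

lemma ip_self_pos:
  assumes "finite G" "supported G f" "f \<noteq> (\<lambda>_. 0)"
  shows "0 < ip G f f"
  using ip_self_eq_0[OF assms(1,2)] ip_nonneg[of G f] assms(3) by linarith

lemma linop_expand:
  assumes "linop S" "finite G" "supported G f"
  shows "S f = (\<lambda>x. \<Sum>y\<in>G. f y * S (\<lambda>z. of_bool (z = y)) x)"
proof -
  have "f = (\<lambda>x. \<Sum>y\<in>G. f y * of_bool (x = y))"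
    using assms(2,3) by (auto simp: fun_eq_iff supported_def of_bool_def if_distrib sum.delta' cong: if_cong)
  then have "S f = S (\<lambda>x. \<Sum>y\<in>G. f y * of_bool (x = y))" by simp
  also have "\<dots> = (\<lambda>x. \<Sum>y\<in>G. f y * S (\<lambda>z. of_bool (z = y)) x)"
    by (rule linop_sum[OF assms(1)])
  finally show ?thesis .
qed

text \<open>A closed subset of a Tychonoff cube: unit norm confines the coordinates in
  \<open>G\<close> to \<open>{-1..1}\<close>, and the others are zero.\<close>

lemma compact_unit_sphere_kernel:
  fixes Z :: "('b \<Rightarrow> real) \<Rightarrow> ('b \<Rightarrow> real)"
  assumes G: "finite G" and Z: "linop Z"
  shows "compact {f. supported G f \<and> Z f = (\<lambda>_. 0) \<and> ip G f f = 1}" (is "compact ?K")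
proof -
  define box where "box = (\<Pi>\<^sub>E x\<in>UNIV. if x \<in> G then {-1..1::real} else {0})"
  have "compactin (product_topology (\<lambda>_. euclidean) UNIV) box"
    unfolding box_def by (subst compactin_PiE) auto
  then have cbox: "compact box" by (simp add: euclidean_product_topology)
  \<comment> \<open>\<open>Z\<close> may be discontinuous on the whole function space; its matrix
    form \<open>Z'\<close> involves finitely many coordinates and agrees with it on supported
    functions.\<close>
  define Z' where "Z' = (\<lambda>f x. \<Sum>y\<in>G. f y * Z (\<lambda>z. of_bool (z = y)) x)"
  have Z': "Z f = Z' f" if "supported G f" for f
    using linop_expand[OF Z G that] by (simp add: Z'_def)
  have cont: "continuous_on UNIV (\<lambda>f::'b \<Rightarrow> real. f x)" for x by simp
  have c1: "closed {f. \<forall>x. Z' f x = 0}"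
    unfolding Z'_def
    by (intro closed_Collect_all closed_Collect_eq continuous_intros cont)
  have c2: "closed {f. ip G f f = 1}"
    unfolding ip_def
    by (intro closed_Collect_eq continuous_intros cont)
  have bound: "f x \<in> {-1..1}" if "ip G f f = 1" "x \<in> G" for f x
  proof -
    have "f x * f x \<le> ip G f f" unfolding ip_def
      using G that(2) by (intro member_le_sum) auto
    then have "(f x)\<^sup>2 \<le> 1" using that by (simp add: power2_eq_square)
    then have "\<bar>f x\<bar> \<le> 1" by (simp add: abs_square_le_1)
    then show ?thesis by auto
  qed
  have "?K = box \<inter> ({f. \<forall>x. Z' f x = 0} \<inter> {f. ip G f f = 1})"
  proof (intro equalityI subsetI)
    fix f assume f: "f \<in> ?K"
    then show "f \<in> box \<inter> ({f. \<forall>x. Z' f x = 0} \<inter> {f. ip G f f = 1})"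
      using bound[of f] Z'[of f] by (auto simp: box_def PiE_def supported_def fun_eq_iff)
  next
    fix f assume f: "f \<in> box \<inter> ({f. \<forall>x. Z' f x = 0} \<inter> {f. ip G f f = 1})"
    have "supported G f" unfolding supported_def
    proof (intro allI impI)
      fix x assume "x \<notin> G"
      have "f x \<in> (if x \<in> G then {-1..1::real} else {0})"
        using f by (auto simp: box_def PiE_def Pi_def)
      then show "f x = 0" using \<open>x \<notin> G\<close> by simp
    qed
    then show "f \<in> ?K" using f Z'[of f] by (auto simp: fun_eq_iff)
  qed
  then show ?thesis
    using compact_Int_closed[OF cbox closed_Int[OF c1 c2]] by simp
qed

text \<open>The kernel of \<open>Z\<close> serves as an invariant subspace; with \<open>Z = 0\<close> it is the whole space.\<close>

lemma max_eigenvector: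
  fixes S Z :: "('b \<Rightarrow> real) \<Rightarrow> ('b \<Rightarrow> real)"
  assumes G: "finite G" and Z: "linop Z" and S: "linop S"
    and supp: "\<And>f. supported G f \<Longrightarrow> supported G (S f)"
    and sa: "\<And>f g. ip G (S f) g = ip G f (S g)"
    and comm: "\<And>f. supported G f \<Longrightarrow> Z (S f) = S (Z f)"
    and f0: "supported G f0" "Z f0 = (\<lambda>_. 0)" "f0 \<noteq> (\<lambda>_. 0)"
  obtains b \<theta> where "supported G b" "Z b = (\<lambda>_. 0)" "b \<noteq> (\<lambda>_. 0)" "S b = (\<lambda>x. \<theta> * b x)"
    "\<And>f. supported G f \<Longrightarrow> Z f = (\<lambda>_. 0) \<Longrightarrow> ip G (S f) f \<le> \<theta> * ip G f f"
proof -
  define X where "X = {f. supported G f \<and> Z f = (\<lambda>_. 0)}"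
  have Xlin: "(\<lambda>x. c * f x + g x) \<in> X" if "f \<in> X" "g \<in> X" for c f g
    using that by (auto simp: X_def linopD[OF Z] supported_def)
  have zX: "(\<lambda>_. 0) \<in> X" by (simp add: X_def supported_def linop_zero[OF Z])
  have Xscale: "(\<lambda>x. c * f x) \<in> X" if "f \<in> X" for c f
    using Xlin[OF that zX, of c] by simp
  have XS: "S f \<in> X" if "f \<in> X" for f
  proof -
    have f: "supported G f" "Z f = (\<lambda>_. 0)" using that by (simp_all add: X_def)
    have "Z (S f) = (\<lambda>_. 0)" unfolding comm[OF f(1)] f(2) by (rule linop_zero[OF S])
    then show ?thesis using supp[OF f(1)] unfolding X_def by blast
  qed
  define K where "K = {f. supported G f \<and> Z f = (\<lambda>_. 0) \<and> ip G f f = 1}"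
  have K: "K = {f \<in> X. ip G f f = 1}" by (auto simp: K_def X_def)
  have cK: "compact K" unfolding K_def by (rule compact_unit_sphere_kernel[OF G Z])
  have unit: "(\<lambda>x. (1 / sqrt (ip G f f)) * f x) \<in> K" if "f \<in> X" "f \<noteq> (\<lambda>_. 0)" for f
  proof -
    have p: "ip G f f > 0" using that ip_self_pos[OF G, of f] by (auto simp: X_def)
    have "ip G (\<lambda>x. (1 / sqrt (ip G f f)) * f x) (\<lambda>x. (1 / sqrt (ip G f f)) * f x)
      = (1 / sqrt (ip G f f)) * ((1 / sqrt (ip G f f)) * ip G f f)"
      by (simp only: ip_scale_left ip_scale_right)
    also have "\<dots> = 1" using p by (simp add: field_simps)
    finally show ?thesis using Xscale[OF that(1)] unfolding K by blast
  qed
  have "K \<noteq> {}" using unit[of f0] f0 by (auto simp: X_def)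
  define R where "R = (\<lambda>f::'b \<Rightarrow> real. \<Sum>x\<in>G. (\<Sum>y\<in>G. f y * S (\<lambda>z. of_bool (z = y)) x) * f x)"
  have R: "ip G (S f) f = R f" if "supported G f" for f
    unfolding R_def by (subst linop_expand[OF S G that]) (simp add: ip_def)
  have cont: "continuous_on K (\<lambda>f::'b \<Rightarrow> real. f x)" for x
    by (rule continuous_on_subset[OF _ subset_UNIV]) simp
  have "continuous_on K R"
    unfolding R_def by (intro continuous_intros cont)
  with continuous_attains_sup[OF cK \<open>K \<noteq> {}\<close>] obtain b where
    b: "b \<in> K" and bmax: "\<forall>f\<in>K. R f \<le> R b" by blast
  define \<theta> where "\<theta> = R b"
  have bX: "b \<in> X" and bb: "ip G b b = 1" using b by (auto simp: K)
  have Rb: "ip G (S b) b = \<theta>" using R[of b] bX by (simp add: \<theta>_def X_def)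
  have ray: "ip G (S f) f \<le> \<theta> * ip G f f" if f: "f \<in> X" for f
  proof (cases "f = (\<lambda>_. 0)")
    case True then show ?thesis by (simp add: ip_def)
  next
    case False
    have p: "ip G f f > 0" using False f ip_self_pos[OF G, of f] by (auto simp: X_def)
    define c where "c = 1 / sqrt (ip G f f)"
    have u: "(\<lambda>x. c * f x) \<in> K" using unit[OF f False] by (simp add: c_def)
    have "R (\<lambda>x. c * f x) = ip G (S (\<lambda>x. c * f x)) (\<lambda>x. c * f x)"
      using R[of "\<lambda>x. c * f x"] u by (simp add: K_def)
    also have "\<dots> = c * (c * ip G (S f) f)"
      by (simp only: linop_scale[OF S] ip_scale_left ip_scale_right)
    also have "\<dots> = ip G (S f) f / ip G f f"
      using p by (simp add: c_def field_simps)
    finally have "ip G (S f) f / ip G f f \<le> \<theta>" using bmax u by (auto simp: \<theta>_def)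
    then show ?thesis using p by (simp add: field_simps)
  qed
  \<comment> \<open>The residual of the eigenvalue equation at the maximizer \<open>b\<close>.
    Inserting \<open>b + r u\<close> into \<open>ray\<close> gives a polynomial in \<open>r\<close>
    with no constant term and linear coefficient \<open>2 * ip G u u\<close>; being nonnegative for
    all \<open>r\<close>, it forces \<open>u = 0\<close>.\<close>
  define u where "u = (\<lambda>x. \<theta> * b x + (- 1) * S b x)"
  have uX: "u \<in> X" unfolding u_def by (intro Xlin bX Xscale XS)
  define B where "B = \<theta> * ip G u u - ip G (S u) u"
  have B0: "B \<ge> 0" using ray[OF uX] by (simp add: B_def)
  have uu: "\<theta> * ip G b u - ip G (S b) u = ip G u u"
    using ip_lin_left[of G \<theta> b "\<lambda>x. (- 1) * S b x" u] ip_scale_left[of G "- 1" "S b" u]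
    unfolding u_def[symmetric] by linarith
  have quad: "0 \<le> 2 * r * ip G u u + r\<^sup>2 * B" for r
  proof -
    have "(\<lambda>x. r * u x + b x) \<in> X" by (intro Xlin uX bX)
    from ray[OF this] have "0 \<le> \<theta> * (r * (r * ip G u u + ip G b u) + (r * ip G b u + ip G b b)) -
      (r * (r * ip G (S u) u + ip G (S u) b) + (r * ip G (S b) u + ip G (S b) b))"
      by (simp only: linopD[OF S] ip_lin_left ip_lin_right ip_commute[of G u b] diff_ge_0_iff_ge)
    moreover have "ip G (S u) b = ip G (S b) u" using sa[of u b] by (simp add: ip_commute)
    ultimately have "0 \<le> 2 * r * (\<theta> * ip G b u - ip G (S b) u) + r\<^sup>2 * B"
      using Rb bb by (simp add: B_def algebra_simps power2_eq_square)
    then show ?thesis by (simp only: uu)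
  qed
  have "ip G u u = 0"
  proof (rule ccontr)
    assume "ip G u u \<noteq> 0"
    then have a: "ip G u u > 0" using ip_nonneg[of G u] by simp
    define q where "q = ip G u u / (B + 1)"
    have q: "q > 0" "ip G u u = q * (B + 1)" using a B0 by (auto simp: q_def)
    have "0 \<le> 2 * (- q) * (q * (B + 1)) + (- q)\<^sup>2 * B" using quad[of "- q"] by (simp only: q(2))
    also have "\<dots> = - (q\<^sup>2 * (B + 2))"
      by (simp add: algebra_simps power2_eq_square)
    also have "\<dots> < 0" using q(1) B0 by simp
    finally show False by simp
  qed
  then have "u = (\<lambda>_. 0)" using ip_self_eq_0[OF G, of u] uX by (auto simp: X_def)
  then have "S b = (\<lambda>x. \<theta> * b x)" by (auto simp: u_def fun_eq_iff)
  moreover have "b \<noteq> (\<lambda>_. 0)" using bb by (auto simp: ip_def)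
  ultimately show ?thesis using that[of b \<theta>] bX ray by (auto simp: X_def)
qed

section \<open>Averages and swaps on functions of permutations\<close>

abbreviation swp :: "'a \<Rightarrow> 'a \<Rightarrow> 'a \<Rightarrow> 'a" where
  "swp \<equiv> Transposition.transpose"

abbreviation perms :: "'a set \<Rightarrow> ('a \<Rightarrow> 'a) set" where
  "perms A \<equiv> {p. p permutes A}"

definition translate :: "('a \<Rightarrow> 'a) \<Rightarrow> (('a \<Rightarrow> 'a) \<Rightarrow> real) \<Rightarrow> (('a \<Rightarrow> 'a) \<Rightarrow> real)" where
  "translate h f = (\<lambda>x. f (x \<circ> h))"

text \<open>For finite \<open>A\<close>, the projection onto functions invariant under right
  multiplication by permutations of \<open>A\<close>.\<close>

definition average :: "'a set \<Rightarrow> (('a \<Rightarrow> 'a) \<Rightarrow> real) \<Rightarrow> (('a \<Rightarrow> 'a) \<Rightarrow> real)" where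
  "average A f = (\<lambda>x. (\<Sum>h\<in>perms A. f (x \<circ> h)) / fact (card A))"

text \<open>The diagonal terms \<open>a = b\<close> are identities, so that this is twice the sum over all
  transpositions plus \<open>card D\<close> times the identity.\<close>

definition swaps :: "'a set \<Rightarrow> (('a \<Rightarrow> 'a) \<Rightarrow> real) \<Rightarrow> (('a \<Rightarrow> 'a) \<Rightarrow> real)" where
  "swaps D f = (\<lambda>x. \<Sum>a\<in>D. \<Sum>b\<in>D. f (x \<circ> swp a b))"

text \<open>The shape expected by \<open>linop_sum\<close> and \<open>ip_sum_left\<close>; hence
  also the factor 1 in \<open>swaps_eq_sum\<close>.\<close>

lemma average_eq_sum: "average A f = (\<lambda>x. \<Sum>h\<in>perms A. (1 / fact (card A)) * translate h f x)"
  by (simp add: average_def translate_def sum_divide_distrib)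

lemma swaps_eq_sum: "swaps D f = (\<lambda>x. \<Sum>p\<in>D \<times> D. 1 * translate (swp (fst p) (snd p)) f x)"
  by (simp add: swaps_def translate_def sum.cartesian_product case_prod_unfold)

lemma swaps_off_diagonal:
  assumes "finite D"
  shows "swaps D f x = real (card D) * f x + (\<Sum>a\<in>D. \<Sum>b\<in>D - {a}. f (x \<circ> swp a b))"
proof -
  have "(\<Sum>b\<in>D. f (x \<circ> swp a b)) = f x + (\<Sum>b\<in>D - {a}. f (x \<circ> swp a b))" if "a \<in> D" for a
    using assms that by (subst sum.remove[of _ a]) auto
  then have "swaps D f x = (\<Sum>a\<in>D. f x + (\<Sum>b\<in>D - {a}. f (x \<circ> swp a b)))"
    unfolding swaps_def by (intro sum.cong) auto
  then show ?thesis by (simp add: sum.distrib)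
qed

lemma linop_average: "linop (average A)"
  by (simp add: linop_def average_def fun_eq_iff sum.distrib sum_distrib_left add_divide_distrib sum_divide_distrib)

lemma linop_swaps: "linop (swaps D)"
  by (simp add: linop_def swaps_def fun_eq_iff sum.distrib sum_distrib_left)

section \<open>Translates: supports and inner products\<close>

lemma supported_translate:
  assumes "h permutes W" "supported (perms W) f"
  shows "supported (perms W) (translate h f)"
  unfolding supported_def translate_def
proof (intro allI impI)
  fix x assume x: "x \<notin> perms W"
  have "x \<circ> h \<notin> perms W"
  proof
    assume "x \<circ> h \<in> perms W"
    then have "(x \<circ> h) \<circ> inv h permutes W"
      using permutes_compose[OF permutes_inv[OF assms(1)]] by blast
    moreover have "(x \<circ> h) \<circ> inv h = x"
      using permutes_inv_o(1)[OF assms(1)] by (simp add: comp_assoc)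
    ultimately show False using x by simp
  qed
  then show "f (x \<circ> h) = 0" using assms(2) by (simp add: supported_def)
qed

lemma supported_average:
  assumes "A \<subseteq> W" "supported (perms W) f"
  shows "supported (perms W) (average A f)"
proof -
  have "f (x \<circ> h) = 0" if "h permutes A" "x \<notin> perms W" for x h
    using supported_translate[OF permutes_subset[OF that(1) assms(1)] assms(2)] that(2)
    by (simp add: supported_def translate_def)
  then show ?thesis by (simp add: supported_def average_def)
qed

lemma supported_swaps:
  assumes "D \<subseteq> W" "supported (perms W) f"
  shows "supported (perms W) (swaps D f)"
proof -
  have "f (x \<circ> swp a b) = 0" if "a \<in> D" "b \<in> D" "x \<notin> perms W" for x a b
    using supported_translate[OF permutes_swap_id[of a W b] assms(2)] that assms(1)
    by (auto simp: supported_def translate_def)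
  then show ?thesis by (simp add: supported_def swaps_def)
qed

lemma ip_translate:
  assumes "h permutes W"
  shows "ip (perms W) (translate h f) g = ip (perms W) f (translate (inv h) g)"
proof -
  have "ip (perms W) f (translate (inv h) g) = (\<Sum>x\<in>perms W. f (x \<circ> h) * g (x \<circ> h \<circ> inv h))"
    unfolding ip_def translate_def by (subst sum_permutations_compose_right[OF assms]) simp
  then show ?thesis
    using permutes_inv_o(1)[OF assms] by (simp add: ip_def translate_def comp_assoc)
qed

lemma ip_translate_translate:
  assumes "h permutes W"
  shows "ip (perms W) (translate h f) (translate h f) = ip (perms W) f f"
  unfolding ip_def translate_def
  by (subst (2) sum_permutations_compose_right[OF assms]) simp

text \<open>Translation preserves the norm, so this is Cauchy-Schwarz, obtained by expanding the
  squares of \<open>u + v\<close> and \<open>u - v\<close>.\<close>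

lemma abs_ip_translate_le:
  assumes "h permutes W"
  shows "\<bar>ip (perms W) (translate h f) f\<bar> \<le> ip (perms W) f f"
proof -
  have *: "\<bar>2 * ip G u v\<bar> \<le> ip G u u + ip G v v" for G :: "('a \<Rightarrow> 'a) set" and u v
  proof -
    have "0 \<le> ip G (\<lambda>x. u x + v x) (\<lambda>x. u x + v x)" "0 \<le> ip G (\<lambda>x. u x - v x) (\<lambda>x. u x - v x)"
      by (rule ip_nonneg)+
    moreover have "2 * ip G u v = (\<Sum>x\<in>G. u x * (v x * 2))"
      by (simp add: ip_def sum_distrib_left mult_ac)
    ultimately show ?thesis
      by (simp add: ip_def algebra_simps sum.distrib sum_subtractf abs_le_iff)
  qed
  show ?thesis using *[of "perms W" "translate h f" f] ip_translate_translate[OF assms, of f] by simp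
qed

section \<open>Invariance and projection properties of averages\<close>

lemma average_translate: 
  assumes "h permutes A"
  shows "average A (translate h f) = average A f"
  unfolding average_def translate_def fun_eq_iff
  by (subst (2) sum_permutations_compose_right[OF assms]) (simp add: comp_assoc)

lemma translate_average:
  assumes "h permutes A"
  shows "translate h (average A f) = average A f"
  unfolding average_def translate_def fun_eq_iff
  by (subst (2) setum_permutations_compose_left[OF assms]) (simp add: comp_assoc)

lemma average_fixed:
  assumes "finite A" "\<And>h. h permutes A \<Longrightarrow> translate h f = f"
  shows "average A f = f"
proof -
  have "f (x \<circ> h) = f x" if "h permutes A" for x h
    using assms(2)[OF that] by (simp add: translate_def fun_eq_iff)
  then show ?thesis
    using assms(1) by (simp add: average_def fun_eq_iff card_permutations)
qed

lemma average_average: "finite A \<Longrightarrow> average A (average A f) = average A f"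
  by (rule average_fixed) (simp_all add: translate_average)

lemma average_empty [simp]: "average {} f = f"
  by (rule average_fixed) (simp_all add: translate_def permutes_empty)

lemma average_singleton [simp]: "average {a} f = f"
  by (rule average_fixed) (simp_all add: translate_def)

lemma average_supset:
  assumes "finite A" "B \<subseteq> A"
  shows "average A (average B f) = average A f"
proof -
  have "average A (average B f) = (\<lambda>x. \<Sum>h\<in>perms B. (1 / fact (card B)) * average A (translate h f) x)"
    by (simp only: average_eq_sum[of B] linop_sum[OF linop_average])
  also have "\<dots> = (\<lambda>x. \<Sum>h\<in>perms B. (1 / fact (card B)) * average A f x)"
    using average_translate[OF permutes_subset[OF _ assms(2)]] by (intro ext sum.cong) auto
  finally show ?thesis
    using finite_subset[OF assms(2,1)] by (simp add: card_permutations)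
qed

lemma ip_sum_left: "ip G (\<lambda>x. \<Sum>i\<in>I. c i * f i x) g = (\<Sum>i\<in>I. c i * ip G (f i) g)"
  unfolding ip_def sum_distrib_left sum_distrib_right by (subst sum.swap) (simp add: mult.assoc)

text \<open>The adjoint of translation by \<open>h\<close> is translation by \<open>inv h\<close>,
  and inversion permutes the group.\<close>

lemma ip_average:
  assumes "A \<subseteq> W"
  shows "ip (perms W) (average A f) g = ip (perms W) f (average A g)"
proof -
  have "ip (perms W) (average A f) g = (\<Sum>h\<in>perms A. (1 / fact (card A)) * ip (perms W) (translate h f) g)"
    by (simp only: average_eq_sum ip_sum_left)
  also have "\<dots> = (\<Sum>h\<in>perms A. (1 / fact (card A)) * ip (perms W) (translate (inv h) g) f)"
    using ip_translate[OF permutes_subset[OF _ assms]] by (intro sum.cong) (auto simp: ip_commute)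
  also have "\<dots> = (\<Sum>h\<in>perms A. (1 / fact (card A)) * ip (perms W) (translate h g) f)"
    by (rule sum_permutations_inverse[symmetric])
  also have "\<dots> = ip (perms W) (average A g) f"
    by (simp only: average_eq_sum ip_sum_left)
  finally show ?thesis by (simp add: ip_commute)
qed

lemma ip_swaps:
  assumes "D \<subseteq> W"
  shows "ip (perms W) (swaps D f) g = ip (perms W) f (swaps D g)"
proof -
  have "ip (perms W) (translate (swp a b) f) g = ip (perms W) (translate (swp a b) g) f"
    if "a \<in> D" "b \<in> D" for a b
    using ip_translate[OF permutes_swap_id[of a W b], of f g] that assms by (auto simp: ip_commute)
  then have "ip (perms W) (swaps D f) g = ip (perms W) (swaps D g) f"
    by (simp only: swaps_eq_sum ip_sum_left) (auto intro!: sum.cong)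
  then show ?thesis by (simp add: ip_commute)
qed

text \<open>Each constant is the number of norm-preserving translations in the sum; the second count
  leaves out the identities.\<close>

lemma abs_ip_swaps_le:
  assumes "D \<subseteq> W"
  shows "\<bar>ip (perms W) (swaps D f) f\<bar> \<le> (real (card D))\<^sup>2 * ip (perms W) f f"
    and "finite D \<Longrightarrow> \<bar>ip (perms W) (\<lambda>x. swaps D f x - real (card D) * f x) f\<bar>
      \<le> real (card D) * (real (card D) - 1) * ip (perms W) f f"
proof -
  have translate: "\<bar>ip (perms W) (translate (swp a b) f) f\<bar> \<le> ip (perms W) f f" if "a \<in> D" "b \<in> D" for a b
    using abs_ip_translate_le[OF permutes_swap_id[of a W b]] that assms by auto
  have "\<bar>ip (perms W) (swaps D f) f\<bar> \<le> (\<Sum>p\<in>D \<times> D. \<bar>1 * ip (perms W) (translate (swp (fst p) (snd p)) f) f\<bar>)"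
    by (simp only: swaps_eq_sum ip_sum_left sum_abs)
  also have "\<dots> \<le> (\<Sum>p\<in>D \<times> D. ip (perms W) f f)"
    using translate by (intro sum_mono) auto
  finally show "\<bar>ip (perms W) (swaps D f) f\<bar> \<le> (real (card D))\<^sup>2 * ip (perms W) f f"
    by (simp add: power2_eq_square card_cartesian_product)
  assume fin: "finite D"
  have eq: "(\<lambda>x. swaps D f x - real (card D) * f x)
      = (\<lambda>x. \<Sum>p\<in>Sigma D (\<lambda>a. D - {a}). 1 * translate (swp (fst p) (snd p)) f x)"
    by (simp add: swaps_off_diagonal[OF fin] translate_def sum.Sigma fin case_prod_unfold)
  have "\<bar>ip (perms W) (\<lambda>x. swaps D f x - real (card D) * f x) f\<bar>
      \<le> (\<Sum>p\<in>Sigma D (\<lambda>a. D - {a}). \<bar>1 * ip (perms W) (translate (swp (fst p) (snd p)) f) f\<bar>)"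
    by (simp only: eq ip_sum_left sum_abs)
  also have "\<dots> \<le> (\<Sum>p\<in>Sigma D (\<lambda>a. D - {a}). ip (perms W) f f)"
    using translate by (intro sum_mono) auto
  also have "\<dots> = real (card (Sigma D (\<lambda>a. D - {a}))) * ip (perms W) f f" by simp
  also have "card (Sigma D (\<lambda>a. D - {a})) = card D * (card D - 1)"
    using fin by (subst card_SigmaI) auto
  finally show "\<bar>ip (perms W) (\<lambda>x. swaps D f x - real (card D) * f x) f\<bar>
      \<le> real (card D) * (real (card D) - 1) * ip (perms W) f f"
    by (cases "card D = 0") (auto simp: of_nat_diff)
qed

text \<open>Conjugation by \<open>h\<close> permutes the transpositions of \<open>D\<close>.\<close>

lemma swaps_translate:
  assumes "h permutes D"
  shows "swaps D (translate h f) = translate h (swaps D f)"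
proof
  fix x
  have "swaps D (translate h f) x = (\<Sum>a\<in>D. \<Sum>b\<in>D. f (x \<circ> h \<circ> swp (inv h a) (inv h b)))"
    unfolding swaps_def translate_def
    by (simp add: comp_assoc transpose_comp_eq[OF permutes_bij[OF assms]])
  also have "\<dots> = (\<Sum>a\<in>D. \<Sum>b\<in>D. f (x \<circ> h \<circ> swp (inv h a) b))"
    using sum.permute[OF permutes_inv[OF assms], of "\<lambda>b. f (x \<circ> h \<circ> swp z b)" for z]
    by (simp add: comp_def)
  also have "\<dots> = (\<Sum>a\<in>D. \<Sum>b\<in>D. f (x \<circ> h \<circ> swp a b))"
    using sum.permute[OF permutes_inv[OF assms], of "\<lambda>a. \<Sum>b\<in>D. f (x \<circ> h \<circ> swp a b)"]
    by (simp add: comp_def)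
  finally show "swaps D (translate h f) x = translate h (swaps D f) x" by (simp add: swaps_def translate_def)
qed

lemma commute_average:
  assumes "linop S" "\<And>h f. h permutes A \<Longrightarrow> S (translate h f) = translate h (S f)"
  shows "S (average A f) = average A (S f)"
proof -
  have "S (average A f) = (\<lambda>x. \<Sum>h\<in>perms A. (1 / fact (card A)) * S (translate h f) x)"
    by (simp only: average_eq_sum linop_sum[OF assms(1)])
  also have "\<dots> = average A (S f)"
    unfolding average_eq_sum using assms(2) by (intro ext sum.cong) auto
  finally show ?thesis .
qed

lemma permutesI_bij: "bij p \<Longrightarrow> (\<And>x. x \<notin> A \<Longrightarrow> p x = x) \<Longrightarrow> p permutes A"
  unfolding permutes_def bij_iff by blast

lemma permutes_conj:
  assumes "k permutes A" "bij h"
  shows "inv h \<circ> k \<circ> h permutes inv h ` A"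
proof (rule permutesI_bij)
  show "bij (inv h \<circ> k \<circ> h)"
    using assms permutes_bij[OF assms(1)] by (intro bij_comp bij_imp_bij_inv)
  fix x assume x: "x \<notin> inv h ` A"
  have "h x \<notin> A"
    using x assms(2) by (metis bij_inv_eq_iff imageI)
  then show "(inv h \<circ> k \<circ> h) x = x"
    using permutes_not_in[OF assms(1)] assms(2) by (simp add: bij_is_inj)
qed

text \<open>\<open>k \<circ> h = h \<circ> (inv h \<circ> k \<circ> h)\<close>, and the conjugate
  runs through the permutations of the preimage of \<open>A\<close> under \<open>h\<close>.\<close>

lemma average_translate_conj:
  assumes "bij h"
  shows "average A (translate h f) = translate h (average (inv h ` A) f)"
proof
  fix x
  have hi: "h \<circ> inv h = id" "inv h \<circ> h = id"
    using assms by (simp_all add: bij_is_surj bij_is_inj surj_iff[symmetric] inj_iff[symmetric])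
  have hh: "h (inv h y) = y" "inv h (h y) = y" for y
    using hi by (auto simp: fun_eq_iff)
  have "(\<Sum>k\<in>perms A. f (x \<circ> k \<circ> h)) = (\<Sum>k\<in>perms (inv h ` A). f (x \<circ> h \<circ> k))"
  proof (rule sum.reindex_bij_witness[of _ "\<lambda>k. h \<circ> k \<circ> inv h" "\<lambda>k. inv h \<circ> k \<circ> h"])
    fix k assume "k \<in> perms (inv h ` A)"
    then have "inv (inv h) \<circ> k \<circ> inv h permutes inv (inv h) ` inv h ` A"
      using permutes_conj[of k "inv h ` A" "inv h"] assms by (simp add: bij_imp_bij_inv)
    then show "h \<circ> k \<circ> inv h \<in> perms A"
      using assms by (simp add: inv_inv_eq image_comp hi)
  next
    fix k assume "k \<in> perms A"
    then show "inv h \<circ> k \<circ> h \<in> perms (inv h ` A)" using permutes_conj assms by blast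
  qed (auto simp: fun_eq_iff hh comp_def)
  moreover have "card (inv h ` A) = card A"
    using assms by (intro card_image) (metis bij_betw_imp_inj_on bij_imp_bij_inv inj_on_subset subset_UNIV)
  ultimately show "average A (translate h f) x = translate h (average (inv h ` A) f) x"
    by (simp add: average_def translate_def)
qed

text \<open>Lets the vanishing of all averages of size \<open>m\<close> survive a further averaging:
  translating \<open>f\<close> only replaces \<open>B\<close> by another subset of \<open>D\<close>
  of the same size.\<close>

lemma average_average_eq_0:
  assumes "finite D" "A \<subseteq> D" "\<And>B. B \<subseteq> D \<Longrightarrow> card B = m \<Longrightarrow> average B f = (\<lambda>_. 0)" "B \<subseteq> D" "card B = m"
  shows "average B (average A f) = (\<lambda>_. 0)"
proof -
  have 0: "average B (translate h f) = (\<lambda>_. 0)" if h: "h permutes A" for h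
  proof -
    have hD: "inv h permutes D" using permutes_inv[OF permutes_subset[OF h assms(2)]] .
    have "inv h ` B \<subseteq> D" using assms(4) permutes_image[OF hD] by blast
    moreover have "card (inv h ` B) = m"
      using assms(5) permutes_inj_on[OF hD] by (simp add: card_image)
    ultimately show ?thesis
      using average_translate_conj[OF permutes_bij[OF h], of B f] assms(3) by (simp add: translate_def)
  qed
  have "average B (average A f) = (\<lambda>x. \<Sum>h\<in>perms A. (1 / fact (card A)) * average B (translate h f) x)"
    by (simp only: average_eq_sum[of A] linop_sum[OF linop_average])
  then show ?thesis using 0 by simp
qed

text \<open>For \<open>b\<close> outside \<open>A\<close>, the transpositions \<open>(a b)\<close> with \<open>a\<close> in \<open>A \<union> {b}\<close> represent the cosets of the
  permutations of \<open>A\<close> in those of \<open>A \<union> {b}\<close>.\<close>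

lemma average_insert:
  assumes "finite A" "b \<notin> A"
  shows "(\<Sum>a\<in>A. average A f (x \<circ> swp a b)) = (real (card A) + 1) * average (insert b A) f x - average A f x"
proof -
  have "average (insert b A) f x = average (insert b A) (average A f) x"
    using assms by (subst average_supset) auto
  also have "\<dots> = (\<Sum>c\<in>insert b A. \<Sum>q\<in>perms A. average A f (x \<circ> (swp b c \<circ> q))) / fact (card A + 1)"
    unfolding average_def[of "insert b A"] using assms
    by (subst sum_over_permutations_insert) auto
  also have "(\<lambda>c q. average A f (x \<circ> (swp b c \<circ> q))) = (\<lambda>c q. translate q (average A f) (x \<circ> swp b c))"
    by (simp add: translate_def comp_assoc)
  also have "(\<Sum>c\<in>insert b A. \<Sum>q\<in>perms A. translate q (average A f) (x \<circ> swp b c))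
    = (\<Sum>c\<in>insert b A. \<Sum>q\<in>perms A. average A f (x \<circ> swp b c))"
    by (intro sum.cong) (auto simp: translate_average)
  also have "\<dots> = fact (card A) * (\<Sum>c\<in>insert b A. average A f (x \<circ> swp b c))"
    using assms by (simp add: card_permutations sum_distrib_left distrib_left)
  also have "\<dots> = fact (card A) * (average A f x + (\<Sum>c\<in>A. average A f (x \<circ> swp c b)))"
    using assms by (simp add: transpose_commute)
  also have "\<dots> / fact (card A + 1) = (average A f x + (\<Sum>c\<in>A. average A f (x \<circ> swp c b))) / (real (card A) + 1)"
    by simp
  finally show ?thesis by (simp add: field_simps)
qed

text \<open>Split the pairs by membership in \<open>A\<close>: swaps inside \<open>A\<close> fix the
  average, mixed pairs are evaluated by \<open>average_insert\<close>, and pairs outside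
  \<open>A\<close> remain.\<close>

lemma swaps_average:
  assumes "finite D" "A \<subseteq> D"
  shows "swaps D (average A f) x = ((real (card A))\<^sup>2 - 2 * real (card (D - A))) * average A f x
    + 2 * (real (card A) + 1) * (\<Sum>b\<in>D - A. average (insert b A) f x) + swaps (D - A) (average A f) x"
proof -
  define E where "E = D - A"
  define F where "F a b = average A f (x \<circ> swp a b)" for a b
  have fin: "finite A" "finite E" and D: "D = A \<union> E" "A \<inter> E = {}"
    using assms finite_subset by (auto simp: E_def)
  have sym: "F a b = F b a" for a b by (simp add: F_def transpose_commute)
  have AA: "(\<Sum>a\<in>A. \<Sum>b\<in>A. F a b) = (real (card A))\<^sup>2 * average A f x"
  proof -
    have "F a b = average A f x" if "a \<in> A" "b \<in> A" for a b
      using translate_average[OF permutes_swap_id[OF that], of f] by (simp add: F_def translate_def fun_eq_iff)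
    then show ?thesis by (simp add: power2_eq_square)
  qed
  have EA: "(\<Sum>b\<in>E. \<Sum>a\<in>A. F a b) = (real (card A) + 1) * (\<Sum>b\<in>E. average (insert b A) f x) - real (card E) * average A f x"
  proof -
    have "(\<Sum>b\<in>E. \<Sum>a\<in>A. F a b) = (\<Sum>b\<in>E. (real (card A) + 1) * average (insert b A) f x - average A f x)"
      using average_insert[OF fin(1)] D(2) by (intro sum.cong) (auto simp: F_def)
    then show ?thesis by (simp add: sum_subtractf sum_distrib_left)
  qed
  have "swaps D (average A f) x = (\<Sum>a\<in>A \<union> E. \<Sum>b\<in>A \<union> E. F a b)"
    by (simp add: swaps_def F_def D(1))
  also have "\<dots> = (\<Sum>a\<in>A. \<Sum>b\<in>A. F a b) + (\<Sum>a\<in>A. \<Sum>b\<in>E. F a b) + (\<Sum>a\<in>E. \<Sum>b\<in>A. F a b) + (\<Sum>a\<in>E. \<Sum>b\<in>E. F a b)"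
    using fin D by (simp add: sum.union_disjoint sum.distrib)
  also have "(\<Sum>a\<in>A. \<Sum>b\<in>E. F a b) = (\<Sum>b\<in>E. \<Sum>a\<in>A. F a b)" by (rule sum.swap)
  also have "(\<Sum>a\<in>E. \<Sum>b\<in>A. F a b) = (\<Sum>b\<in>E. \<Sum>a\<in>A. F a b)" by (intro sum.cong refl sym)
  also have "(\<Sum>a\<in>E. \<Sum>b\<in>E. F a b) = swaps E (average A f) x" by (simp add: swaps_def F_def)
  finally show ?thesis by (simp add: AA EA E_def[symmetric] algebra_simps)
qed

section \<open>The eigenvalues of the lazy transposition walk\<close>

text \<open>Choose \<open>A\<close> of maximal size with nonzero average; singletons qualify. Then
  the averages over \<open>insert b A\<close> in \<open>swaps_average\<close> vanish, which leaves
  an eigenvalue equation on \<open>D - A\<close>.\<close>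

lemma top_average:
  assumes "finite D" "D \<noteq> {}" "g \<noteq> (\<lambda>_. 0)" "swaps D g = (\<lambda>x. \<theta> * g x)"
  obtains A where "A \<subseteq> D" "A \<noteq> {}" "average A g \<noteq> (\<lambda>_. 0)"
    "\<And>B. B \<subseteq> D \<Longrightarrow> card B = Suc (card A) \<Longrightarrow> average B g = (\<lambda>_. 0)"
    "swaps D (average A g) = (\<lambda>x. \<theta> * average A g x)"
    "swaps (D - A) (average A g)
      = (\<lambda>x. (\<theta> - (real (card A))\<^sup>2 + 2 * real (card (D - A))) * average A g x)"
proof -
  define P where "P = {B. B \<subseteq> D \<and> average B g \<noteq> (\<lambda>_. 0)}"
  have finP: "finite P" using assms(1) by (simp add: P_def)
  obtain d where d: "d \<in> D" using assms(2) by blast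
  have dP: "{d} \<in> P" using d assms(3) by (simp add: P_def)
  have "Max (card ` P) \<in> card ` P" using finP dP by (intro Max_in) auto
  then obtain A where A: "A \<in> P" "card A = Max (card ` P)" by auto
  have max: "card B \<le> card A" if "B \<in> P" for B
    using that finP by (auto simp: A(2))
  have AD: "A \<subseteq> D" using A(1) by (simp add: P_def)
  have "card A \<ge> 1" using max[OF dP] by simp
  then have "A \<noteq> {}" by auto
  have zero: "average B g = (\<lambda>_. 0)" if "B \<subseteq> D" "card B = Suc (card A)" for B
    using max[of B] that by (auto simp: P_def)
  have eig: "swaps D (average A g) = (\<lambda>x. \<theta> * average A g x)"
  proof -
    have "swaps D (average A g) = average A (swaps D g)"
      using swaps_translate permutes_subset[OF _ AD] by (intro commute_average linop_swaps) blast
    then show ?thesis using linop_scale[OF linop_average] by (simp add: assms(4))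
  qed
  have ins: "average (insert b A) g = (\<lambda>_. 0)" if "b \<in> D - A" for b
    using that AD finite_subset[OF AD assms(1)] by (intro zero) auto
  have "swaps (D - A) (average A g) x = (\<theta> - (real (card A))\<^sup>2 + 2 * real (card (D - A))) * average A g x" for x
  proof -
    have "\<theta> * average A g x = ((real (card A))\<^sup>2 - 2 * real (card (D - A))) * average A g x + swaps (D - A) (average A g) x"
      using swaps_average[OF assms(1) AD, of g x] ins by (simp add: eig)
    then show ?thesis by (simp add: algebra_simps)
  qed
  then show ?thesis
    using that[OF AD \<open>A \<noteq> {}\<close>] A(1) zero eig by (auto simp: P_def)
qed

text \<open>Remove a top set \<open>A\<close> of size \<open>a\<close> and apply induction to
  \<open>average A g\<close> on \<open>D - A\<close>, with \<open>a\<close> for \<open>m\<close>.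
  With \<open>e = card (D - A)\<close> this gives \<open>\<theta> \<le> a^2 + a * e - 2 * e\<close>,
  at most \<open>a * card D\<close>.\<close>

lemma swaps_eigenvalue_le:
  assumes "finite D" "g \<noteq> (\<lambda>_. 0)" "swaps D g = (\<lambda>x. \<theta> * g x)"
    and "\<And>B. B \<subseteq> D \<Longrightarrow> card B = Suc m \<Longrightarrow> average B g = (\<lambda>_. 0)"
  shows "\<theta> \<le> real m * real (card D)"
  using assms
proof (induction "card D" arbitrary: D g \<theta> m rule: less_induct)
  case less
  note fin = less.prems(1) and g = less.prems(2) and eig = less.prems(3) and zero = less.prems(4)
  show ?case
  proof (cases "D = {}")
    case True
    have "(\<lambda>x. \<theta> * g x) = (\<lambda>_. 0)" using eig by (simp add: True swaps_def)
    then have "\<theta> = 0" using g by (auto simp: fun_eq_iff)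
    then show ?thesis by simp
  next
    case False
    obtain A where A: "A \<subseteq> D" "A \<noteq> {}" "average A g \<noteq> (\<lambda>_. 0)"
      and Azero: "\<And>B. B \<subseteq> D \<Longrightarrow> card B = Suc (card A) \<Longrightarrow> average B g = (\<lambda>_. 0)"
      and Aeig: "swaps (D - A) (average A g)
        = (\<lambda>x. (\<theta> - (real (card A))\<^sup>2 + 2 * real (card (D - A))) * average A g x)"
      using top_average[OF fin False g eig] by metis
    have finA: "finite A" using A(1) fin finite_subset by blast
    \<comment> \<open>A larger \<open>A\<close> would contain a set of size \<open>Suc m\<close>,
      whose zero average forces the average over \<open>A\<close> to vanish.\<close>
    have "card A \<le> m"
    proof (rule ccontr)
      assume "\<not> card A \<le> m"
      then obtain B where B: "B \<subseteq> A" "card B = Suc m"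
        using obtain_subset_with_card_n[of "Suc m" A] by auto
      have "average A (average B g) = (\<lambda>_. 0)"
        using zero[of B] B A(1) by (simp add: linop_zero[OF linop_average])
      then show False using average_supset[OF finA B(1), of g] A(3) by simp
    qed
    have cD: "card D = card A + card (D - A)"
      using A(1) fin finA by (simp add: card_Diff_subset card_mono)
    have "card A > 0" using A(2) finA by (simp add: card_gt_0_iff)
    then have "card (D - A) < card D" using cD by simp
    then have "\<theta> - (real (card A))\<^sup>2 + 2 * real (card (D - A)) \<le> real (card A) * real (card (D - A))"
    proof (rule less.hyps[OF _ _ A(3) Aeig])
      show "finite (D - A)" using fin by simp
      fix B assume "B \<subseteq> D - A" "card B = Suc (card A)"
      then show "average B (average A g) = (\<lambda>_. 0)"
        using average_average_eq_0[OF fin A(1) Azero] by blast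
    qed
    then have "\<theta> \<le> real (card A) * real (card D)"
      by (simp add: cD power2_eq_square algebra_simps)
    also have "\<dots> \<le> real m * real (card D)" using \<open>card A \<le> m\<close> by (simp add: mult_right_mono)
    finally show ?thesis .
  qed
qed

text \<open>Subtracting the diagonal leaves each edge counted twice, hence
  \<open>card W * (card W - 1)\<close>; the other factor 2 is the laziness.\<close>

definition walk :: "'a set \<Rightarrow> (('a \<Rightarrow> 'a) \<Rightarrow> real) \<Rightarrow> (('a \<Rightarrow> 'a) \<Rightarrow> real)" where
  "walk W f = (\<lambda>x. f x / 2 + (swaps W f x - real (card W) * f x) / (2 * real (card W) * (real (card W) - 1)))"

section \<open>Linearity, symmetry and translation invariance of the walk\<close>

lemma linop_walk: "linop (walk W)"
  unfolding linop_def walk_def linopD[OF linop_swaps]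
  by (simp add: algebra_simps add_divide_distrib diff_divide_distrib)

lemma linop_funpow: "linop S \<Longrightarrow> linop (S ^^ t)"
  by (induction t) (simp_all add: linop_def)

lemma supported_walk:
  assumes "supported (perms W) f" shows "supported (perms W) (walk W f)"
  using assms supported_swaps[OF subset_refl assms] by (simp add: supported_def walk_def)

lemma supported_walk_funpow:
  "supported (perms W) f \<Longrightarrow> supported (perms W) ((walk W ^^ t) f)"
  by (induction t) (simp_all add: supported_walk)

lemma walk_eq:
  "walk W f = (\<lambda>x. (1 / 2 - 1 / (2 * (real (card W) - 1))) * f x
    + 1 / (2 * real (card W) * (real (card W) - 1)) * swaps W f x)" if "card W > 0"
proof -
  have eq: "real (card W) / (2 * real (card W) * (real (card W) - 1)) = 1 / (2 * (real (card W) - 1))"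
    using that by simp
  have "walk W f x = f x / 2 + swaps W f x / (2 * real (card W) * (real (card W) - 1))
      - (real (card W) / (2 * real (card W) * (real (card W) - 1))) * f x" for x
    by (simp add: walk_def diff_divide_distrib)
  then show ?thesis unfolding eq by (simp add: fun_eq_iff left_diff_distrib)
qed

lemma ip_walk:
  assumes "card W > 0"
  shows "ip (perms W) (walk W f) g = ip (perms W) f (walk W g)"
  unfolding walk_eq[OF assms] ip_lin_left ip_lin_right ip_scale_left ip_scale_right
  by (simp add: ip_swaps)

lemma ip_walk_funpow:
  assumes "card W > 0"
  shows "ip (perms W) ((walk W ^^ t) f) g = ip (perms W) f ((walk W ^^ t) g)"
  by (induction t arbitrary: f g) (simp_all add: ip_walk[OF assms] funpow_swap1)

lemma walk_translate:
  assumes "h permutes W"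
  shows "walk W (translate h f) = translate h (walk W f)"
  unfolding walk_def swaps_translate[OF assms] by (simp add: translate_def)

lemma walk_funpow_translate:
  assumes "h permutes W"
  shows "(walk W ^^ t) (translate h f) = translate h ((walk W ^^ t) f)"
  by (induction t) (simp_all add: walk_translate[OF assms])

text \<open>Here \<open>j = n - m\<close>, where \<open>m\<close> is the size of the largest set with a nonzero average. The first
  value is the eigenvalue of the partition \<open>(n - j, j)\<close>, the second one comes from the bound
  \<open>\<theta> \<le> m n\<close> for the eigenvalue of \<open>swaps\<close>.\<close>

definition walk_bound :: "nat \<Rightarrow> nat \<Rightarrow> real" where
  "walk_bound n j = (if 2 * j \<le> n then 1 - real j * (real n - real j + 1) / (real n * (real n - 1))
     else 1 - real j / (2 * (real n - 1)))"

lemma ip_average_self: "A \<subseteq> W \<Longrightarrow> finite A \<Longrightarrow> ip (perms W) (average A f) f = ip (perms W) (average A f) (average A f)"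
  by (subst ip_average[symmetric]) (simp_all add: average_average ip_average)

text \<open>The weights depend only on the size, so moving all sets by \<open>h\<close> just
  reorders the sum.\<close>

lemma sum_average_translate:
  assumes "h permutes W" "finite W"
  shows "(\<Sum>A\<in>Pow W - {{}}. w (card A) * average A (translate h f) x)
       = (\<Sum>A\<in>Pow W - {{}}. w (card A) * average A f (x \<circ> h))"
proof (rule sum.reindex_bij_witness[of _ "\<lambda>A. h ` A" "\<lambda>A. inv h ` A"])
  have b: "bij h" using permutes_bij[OF assms(1)] .
  have im: "h ` inv h ` A = A" "inv h ` h ` A = A" for A
    using b by (auto simp: image_comp bij_is_surj bij_is_inj surj_iff[THEN iffD1] inj_iff[THEN iffD1])
  have inj: "inj_on (inv h) A" for A
    using permutes_inj_on[OF permutes_inv[OF assms(1)]] by (rule inj_on_subset) auto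
  fix A
  show "h ` inv h ` A = A" "inv h ` h ` A = A" by (rule im)+
  assume A: "A \<in> Pow W - {{}}"
  show "h ` A \<in> Pow W - {{}}" using A permutes_image[OF assms(1)] by blast
  show "inv h ` A \<in> Pow W - {{}}" using A permutes_image[OF permutes_inv[OF assms(1)]] by blast
  show "w (card (inv h ` A)) * average (inv h ` A) f (x \<circ> h) = w (card A) * average A (translate h f) x"
    using average_translate_conj[OF b, of A f] card_image[OF inj, of A] by (simp add: translate_def)
qed

text \<open>Laziness makes \<open>\<rho>\<close> nonnegative. The two cases of
  \<open>walk_bound\<close> come from the estimates \<open>t2\<close> and \<open>t1\<close> of
  \<open>\<theta>\<close>.\<close>

lemma walk_eigenvalue_bounds:
  assumes W: "finite W" "2 \<le> card W" and b: "supported (perms W) b" "swaps W b = (\<lambda>x. \<theta> * b x)"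
    and A: "A \<subseteq> W" "A \<noteq> {}" "average A b \<noteq> (\<lambda>_. 0)"
    and Azero: "\<And>B. B \<subseteq> W \<Longrightarrow> card B = Suc (card A) \<Longrightarrow> average B b = (\<lambda>_. 0)"
    and Aeig: "swaps (W - A) (average A b)
        = (\<lambda>x. (\<theta> - (real (card A))\<^sup>2 + 2 * real (card (W - A))) * average A b x)"
  defines "n \<equiv> real (card W)"
  defines "\<rho> \<equiv> 1 / 2 + (\<theta> - n) / (2 * n * (n - 1))"
  shows "0 \<le> \<rho>" "\<rho> \<le> walk_bound (card W) (card W - card A)"
proof -
  define j where "j = card W - card A"
  have finA: "finite A" using A(1) W(1) finite_subset by blast
  have finG: "finite (perms W)" by (simp add: W finite_permutations)
  have n: "n \<ge> 2" using W(2) by (simp add: n_def)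
  have cA: "card A \<le> card W" using A(1) W(1) by (simp add: card_mono)
  have cj: "card (W - A) = j" using A(1) finA by (simp add: j_def card_Diff_subset)
  have cA': "real (card A) = n - real j" using cA by (simp add: j_def n_def of_nat_diff)
  have b0: "b \<noteq> (\<lambda>_. 0)" using A(3) linop_zero[OF linop_average, of A] by auto
  have bpos: "ip (perms W) b b > 0" using ip_self_pos[OF finG b(1) b0] .
  have gpos: "ip (perms W) (average A b) (average A b) > 0"
    using ip_self_pos[OF finG supported_average[OF A(1) b(1)] A(3)] .
  have "\<bar>ip (perms W) (\<lambda>x. swaps W b x - real (card W) * b x) b\<bar>
      \<le> n * (n - 1) * ip (perms W) b b"
    using abs_ip_swaps_le(2)[of W W b] W(1) by (simp add: n_def)
  also have "(\<lambda>x. swaps W b x - real (card W) * b x) = (\<lambda>x. (\<theta> - n) * b x)"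
    by (simp add: b(2) n_def algebra_simps)
  finally have "\<bar>\<theta> - n\<bar> \<le> n * (n - 1)"
    using bpos by (simp add: ip_scale_left abs_mult)
  then have "\<theta> - n \<ge> - (n * (n - 1))" by linarith
  then show "0 \<le> \<rho>" using n by (simp add: \<rho>_def field_simps)
  have t1: "\<theta> \<le> (n - real j) * n"
  proof -
    have "\<theta> \<le> real (card A) * real (card W)"
      by (rule swaps_eigenvalue_le[OF W(1) b0 b(2)]) (rule Azero)
    then show ?thesis by (simp only: cA' n_def)
  qed
  \<comment> \<open>On \<open>W - A\<close> the operator is a sum of \<open>j * j\<close>
    norm-preserving translations, which bounds its eigenvalue; this estimate is the sharper one for
    \<open>2 * j \<le> n\<close>.\<close>
  have "\<bar>ip (perms W) (swaps (W - A) (average A b)) (average A b)\<bar> \<le> (real j)\<^sup>2 * ip (perms W) (average A b) (average A b)"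
    using abs_ip_swaps_le(1)[of "W - A" W "average A b"] by (simp add: cj)
  then have "\<bar>\<theta> - (real (card A))\<^sup>2 + 2 * real (card (W - A))\<bar> \<le> (real j)\<^sup>2"
    using gpos by (simp add: Aeig ip_scale_left abs_mult)
  then have t2: "\<theta> \<le> (n - real j)\<^sup>2 + (real j)\<^sup>2 - 2 * real j"
    by (simp add: cA' cj)
  have "\<rho> \<le> 1 / 2 + ((n - real j) * n - n) / (2 * n * (n - 1))"
    using n t1 by (simp add: \<rho>_def divide_right_mono)
  also have "\<dots> = 1 - real j / (2 * (n - 1))"
    using n by (simp add: field_simps)
  finally have r1: "\<rho> \<le> 1 - real j / (2 * (n - 1))" .
  have "\<rho> \<le> 1 / 2 + ((n - real j)\<^sup>2 + (real j)\<^sup>2 - 2 * real j - n) / (2 * n * (n - 1))"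
    using n t2 by (simp add: \<rho>_def divide_right_mono)
  also have "\<dots> = 1 - real j * (n - real j + 1) / (n * (n - 1))"
    using n by (simp add: field_simps power2_eq_square)
  finally have r2: "\<rho> \<le> 1 - real j * (n - real j + 1) / (n * (n - 1))" .
  show "\<rho> \<le> walk_bound (card W) (card W - card A)"
    using r1 r2 by (simp add: walk_bound_def j_def[symmetric] n_def[symmetric])
qed

text \<open>If the difference of the two sides had a positive eigenvalue, its eigenspace would contain an
  eigenfunction of the walk. A largest nonzero average of that eigenfunction stays in the
  eigenspace and is fixed by one of the averages on the right, whose coefficient exceeds the
  eigenvalue of the walk.\<close>

lemma walk_even_power_le_averages:
  assumes W: "finite W" "2 \<le> card W" and f: "supported (perms W) f"
  shows "ip (perms W) ((walk W ^^ (2 * t)) f) f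
    \<le> (\<Sum>A\<in>Pow W - {{}}. walk_bound (card W) (card W - card A) ^ (2 * t) * ip (perms W) (average A f) f)"
proof (rule ccontr)
  let ?ip = "ip (perms W)"
  define w where "w m = walk_bound (card W) (card W - m) ^ (2 * t)" for m
  \<comment> \<open>The even exponent makes the weights nonnegative whatever the sign of
    \<open>walk_bound\<close>.\<close>
  have w0: "w m \<ge> 0" for m by (simp add: w_def)
  define S where "S f = (\<lambda>x. (walk W ^^ (2 * t)) f x - (\<Sum>A\<in>Pow W - {{}}. w (card A) * average A f x))" for f
  have finG: "finite (perms W)" by (simp add: W finite_permutations)
  have linS: "linop S"
    unfolding linop_def S_def linopD[OF linop_funpow[OF linop_walk]] linopD[OF linop_average]
    by (simp add: algebra_simps sum.distrib sum_distrib_left)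
  have suppS: "supported (perms W) (S f)" if "supported (perms W) f" for f
    using supported_walk_funpow[OF that] supported_average[OF _ that] by (auto simp: supported_def S_def)
  have ipS: "?ip (S f) g = ?ip ((walk W ^^ (2 * t)) f) g - (\<Sum>A\<in>Pow W - {{}}. w (card A) * ?ip (average A f) g)" for f g
  proof -
    have "S f = (\<lambda>x. (- 1) * (\<Sum>A\<in>Pow W - {{}}. w (card A) * average A f x) + (walk W ^^ (2 * t)) f x)"
      by (simp add: S_def)
    then show ?thesis by (simp only: ip_lin_left ip_sum_left)
  qed
  have saS: "?ip (S f) g = ?ip f (S g)" for f g
  proof -
    have "(\<Sum>A\<in>Pow W - {{}}. w (card A) * ?ip (average A f) g) = (\<Sum>A\<in>Pow W - {{}}. w (card A) * ?ip (average A g) f)"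
      using ip_average by (intro sum.cong) (auto simp: ip_commute)
    moreover have "?ip ((walk W ^^ (2 * t)) f) g = ?ip ((walk W ^^ (2 * t)) g) f"
      using W(2) ip_walk_funpow[of W "2 * t" f g] by (simp add: ip_commute)
    ultimately show ?thesis using ipS[of f g] ipS[of g f] by (simp add: ip_commute)
  qed
  have trS: "S (translate h f) = translate h (S f)" if "h permutes W" for h f
    using walk_funpow_translate[OF that, of "2 * t" f] sum_average_translate[OF that W(1), of w f]
    by (simp add: S_def translate_def)
  have swS: "S (swaps W f) = swaps W (S f)" for f
    by (simp only: swaps_eq_sum linop_sum[OF linS])
      (auto intro!: ext sum.cong simp: trS permutes_swap_id)
  assume "\<not> ?thesis"
  then have pos: "?ip (S f) f > 0" using ipS[of f f] by (simp add: w_def)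
  then have f0: "f \<noteq> (\<lambda>_. 0)" by (auto simp: ip_def)
  have linZ: "linop (\<lambda>_ _. 0 :: real)" by (simp add: linop_def)
  obtain b0 q where b0: "supported (perms W) b0" "b0 \<noteq> (\<lambda>_. 0)" "S b0 = (\<lambda>x. q * b0 x)"
    and q: "\<And>f. supported (perms W) f \<Longrightarrow> ?ip (S f) f \<le> q * ?ip f f"
    using max_eigenvector[OF finG linZ linS suppS saS _ f _ f0] by (auto simp: linop_zero[OF linS])
  have "q * ?ip f f > 0" using q[OF f] pos by linarith
  then have qpos: "q > 0" using ip_nonneg[of "perms W" f] by (auto simp: zero_less_mult_iff)
  \<comment> \<open>The kernel of \<open>Z\<close> is the eigenspace of \<open>S\<close> for
    \<open>q\<close>; \<open>swaps W\<close> preserves it and so has an eigenfunction there.\<close>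
  define Z where "Z f = (\<lambda>x. S f x - q * f x)" for f
  have linZ: "linop Z" unfolding linop_def Z_def linopD[OF linS] by (simp add: algebra_simps)
  have commZ: "Z (swaps W f) = swaps W (Z f)" for f
  proof -
    have "Z f = (\<lambda>x. (- q) * f x + S f x)" for f by (simp add: Z_def)
    then show ?thesis by (simp only: swS linopD[OF linop_swaps])
  qed
  have Zb0: "Z b0 = (\<lambda>_. 0)" by (simp add: Z_def b0(3))
  obtain b \<theta> where b: "supported (perms W) b" "Z b = (\<lambda>_. 0)" "b \<noteq> (\<lambda>_. 0)" "swaps W b = (\<lambda>x. \<theta> * b x)"
    using max_eigenvector[OF finG linZ linop_swaps[of W] supported_swaps[OF subset_refl] ip_swaps[OF subset_refl] commZ
        b0(1) Zb0 b0(2)] by metis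
  have "W \<noteq> {}" using W(2) by auto
  obtain A where A: "A \<subseteq> W" "A \<noteq> {}" "average A b \<noteq> (\<lambda>_. 0)"
      and Azero: "\<And>B. B \<subseteq> W \<Longrightarrow> card B = Suc (card A) \<Longrightarrow> average B b = (\<lambda>_. 0)"
      and geig: "swaps W (average A b) = (\<lambda>x. \<theta> * average A b x)"
      and Aeig: "swaps (W - A) (average A b)
        = (\<lambda>x. (\<theta> - (real (card A))\<^sup>2 + 2 * real (card (W - A))) * average A b x)"
    using top_average[OF W(1) \<open>W \<noteq> {}\<close> b(3,4)] by metis
  have finA: "finite A" using A(1) W(1) finite_subset by blast
  define g where "g = average A b"
  define n where "n = real (card W)"
  define \<rho> where "\<rho> = 1 / 2 + (\<theta> - n) / (2 * n * (n - 1))"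
  have \<rho>: "0 \<le> \<rho>" "\<rho> \<le> walk_bound (card W) (card W - card A)"
    using walk_eigenvalue_bounds[OF W b(1,4) A Azero Aeig] by (simp_all add: \<rho>_def n_def)
  have "walk W g = (\<lambda>x. \<rho> * g x)"
    using geig by (auto simp: walk_def g_def \<rho>_def n_def fun_eq_iff algebra_simps diff_divide_distrib)
  then have wg: "(walk W ^^ k) g = (\<lambda>x. \<rho> ^ k * g x)" for k
  proof (induction k)
    case (Suc k)
    have "(walk W ^^ Suc k) g = walk W (\<lambda>x. \<rho> ^ k * g x)" by (simp add: Suc)
    also have "\<dots> = (\<lambda>x. \<rho> ^ Suc k * g x)"
      unfolding linop_scale[OF linop_walk] \<open>walk W g = (\<lambda>x. \<rho> * g x)\<close> by (simp add: mult_ac)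
    finally show ?case .
  qed simp
  have gpos: "?ip g g > 0"
    using ip_self_pos[OF finG supported_average[OF A(1) b(1)] A(3)] by (simp add: g_def)
  have "S g = average A (S b)"
    unfolding g_def using trS permutes_subset[OF _ A(1)] by (intro commute_average linS) blast
  also have "S b = (\<lambda>x. q * b x)" using b(2) by (simp add: Z_def fun_eq_iff)
  finally have Sg: "S g = (\<lambda>x. q * g x)" by (simp add: linop_scale[OF linop_average] g_def)
  \<comment> \<open>The term of \<open>A\<close> has its full weight, since averaging over
    \<open>A\<close> fixes \<open>g\<close>, and the other terms are nonnegative. So
    \<open>q\<close> is at most \<open>\<rho> ^ (2 * t) - w (card A)\<close>, which is not
    positive.\<close>
  have "w (card A) * ?ip g g = w (card A) * ?ip (average A g) g"
    by (simp add: g_def average_average[OF finA])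
  also have "\<dots> \<le> (\<Sum>A\<in>Pow W - {{}}. w (card A) * ?ip (average A g) g)"
  proof (rule member_le_sum)
    fix B assume "B \<in> Pow W - {{}} - {A}"
    then have "?ip (average B g) g = ?ip (average B g) (average B g)"
      using W(1) finite_subset by (intro ip_average_self) auto
    then show "0 \<le> w (card B) * ?ip (average B g) g" using w0 by (simp add: ip_nonneg)
  qed (use A W in auto)
  finally have "q * ?ip g g \<le> \<rho> ^ (2 * t) * ?ip g g - w (card A) * ?ip g g"
    using ipS[of g g] by (simp add: Sg wg ip_scale_left)
  moreover have "\<rho> ^ (2 * t) \<le> w (card A)"
    unfolding w_def using \<rho> by (intro power_mono) auto
  then have "\<rho> ^ (2 * t) * ?ip g g \<le> w (card A) * ?ip g g"
    using gpos by (intro mult_right_mono) auto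
  ultimately have "q * ?ip g g \<le> 0" by linarith
  then show False using qpos gpos by (simp add: mult_le_0_iff)
qed

section \<open>Square-mean convergence from all particles labelled\<close>

lemma power_le_exp_fact: "real j ^ j \<le> exp (real j) * fact j"
proof -
  have "(\<lambda>i. real j ^ i /\<^sub>R fact i) sums exp (real j)" by (rule exp_converges)
  then have "(\<Sum>i\<in>{j}. real j ^ i /\<^sub>R fact i) \<le> exp (real j)"
    by (intro sum_le_suminf[THEN order_trans]) (auto simp: sums_iff)
  then show ?thesis by (simp add: field_simps)
qed

text \<open>\<open>ln x / x\<close> decreases beyond \<open>exp 1\<close>. The case
  \<open>j = 1\<close> is separate because \<open>2 * j\<close> is below \<open>exp 1\<close>
  there.\<close>

lemma ln_over_le:
  assumes "1 \<le> j" "2 * j \<le> (n::nat)"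
  shows "2 * (real j - 1) * ln (real n) / real n \<le> ln (2 * real j)"
proof (cases "j = 1")
  case False
  then have j: "real j \<ge> 2" using assms by simp
  have "ln (real n) / real n \<le> ln (2 * real j) / (2 * real j)"
    using exp_le j assms by (intro ln_x_over_x_mono) auto
  then have "2 * (real j - 1) * (ln (real n) / real n) \<le> 2 * (real j - 1) * (ln (2 * real j) / (2 * real j))"
    using j by (intro mult_left_mono) auto
  also have "\<dots> = ((real j - 1) / real j) * ln (2 * real j)"
    using j by (simp add: field_simps)
  also have "\<dots> \<le> 1 * ln (2 * real j)"
    using j by (intro mult_right_mono) auto
  finally show ?thesis by simp
qed simp

text \<open>For \<open>2 * j \<le> n\<close> the combinatorial factor is bounded by
  \<open>n^(2 * j) / fact j\<close>, otherwise by \<open>4^j * n^j\<close>; the power of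
  \<open>walk_bound\<close>, estimated by \<open>1 - y \<le> exp (- y)\<close>, cancels the power of
  \<open>n\<close>.\<close>

lemma walk_bound_term_le:
  fixes c :: real
  assumes j: "1 \<le> j" "j < n" and c: "0 \<le> c" and t: "real n * ln (real n) + c * real n \<le> real t"
  shows "walk_bound n j ^ (2 * t) * ((real (n choose j))\<^sup>2 * fact j) \<le> (6 * exp (- c)) ^ j"
proof -
  have n2: "real n \<ge> 2" using j by simp
  have lnn: "ln (real n) \<ge> 0" using n2 by simp
  have nj: "real n ^ j = exp (real j * ln (real n))"
    using n2 by (simp add: exp_of_nat_mult)
  have cb: "real (n choose j) * fact j \<le> real n ^ j"
    using binomial_fact_pow[of n j] by (metis of_nat_fact of_nat_le_iff of_nat_mult of_nat_power)
  have expbd: "(1 - y) ^ (2 * t) \<le> exp (- (2 * real t * y))" if "0 \<le> 1 - y" for y :: real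
  proof -
    have "(1 - y) ^ (2 * t) \<le> exp (- y) ^ (2 * t)"
      using that exp_ge_add_one_self[of "- y"] by (intro power_mono) auto
    also have "\<dots> = exp (- (2 * real t * y))"
      by (simp add: exp_of_nat_mult[symmetric])
    finally show ?thesis .
  qed
  show ?thesis
  proof (cases "2 * j \<le> n")
    case True
    then have J: "2 * real j \<le> real n" by linarith
    define y where "y = real j * (real n - real j + 1) / (real n * (real n - 1))"
    have y0: "0 \<le> y" using j n2 by (simp add: y_def)
    have "real j * (real n - real j + 1) \<le> (real n - 1) * real n"
      using j n2 by (intro mult_mono) auto
    then have y1: "0 \<le> 1 - y" using n2 by (simp add: y_def field_simps)
    have "2 * real t * y \<ge> 2 * (real n * (ln (real n) + c)) * y"
      using t y0 by (intro mult_right_mono) (auto simp: algebra_simps)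
    moreover have "2 * (real n * (ln (real n) + c)) * y
        = (2 * real j * (ln (real n) + c)) * ((real n - real j + 1) / (real n - 1))"
      using n2 by (simp add: y_def field_simps)
    moreover have "(2 * real j * (ln (real n) + c)) * ((real n - real j + 1) / (real n - 1))
        \<ge> (2 * real j * (ln (real n) + c)) * ((real n - real j + 1) / real n)"
      using n2 j c lnn by (intro mult_left_mono divide_left_mono mult_pos_pos) auto
    \<comment> \<open>The main term \<open>2 * j * ln n\<close> cancels \<open>n^(2 * j)\<close>. By
      \<open>ln_over_le\<close> the correction costs at most \<open>(2 * j)^j\<close>, which the
      factorial absorbs up to \<open>(2 * exp 1)^j\<close>.\<close>
    moreover have "(2 * real j * (ln (real n) + c)) * ((real n - real j + 1) / real n)
        = 2 * real j * ln (real n) - real j * (2 * (real j - 1) * ln (real n) / real n)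
          + (c * real j) * (2 * (real n - real j + 1) / real n)"
      using n2 by (simp add: field_simps)
    moreover have "(c * real j) * (2 * (real n - real j + 1) / real n) \<ge> (c * real j) * 1"
      using n2 J c by (intro mult_left_mono) (auto simp: field_simps)
    moreover have "real j * (2 * (real j - 1) * ln (real n) / real n) \<le> real j * ln (2 * real j)"
      using ln_over_le[OF j(1) True] by (intro mult_left_mono) auto
    ultimately have "2 * real t * y \<ge> 2 * real j * ln (real n) - real j * ln (2 * real j) + c * real j"
      by linarith
    then have "(1 - y) ^ (2 * t) \<le> exp (- (2 * real j * ln (real n) - real j * ln (2 * real j) + c * real j))"
      using expbd[OF y1] by (meson exp_le_cancel_iff neg_le_iff_le order_trans)
    also have "- (2 * real j * ln (real n) - real j * ln (2 * real j) + c * real j)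
        = real j * ln (2 * real j) + real j * (- c) - real j * ln (real n) - real j * ln (real n)"
      by (simp add: algebra_simps)
    also have "exp \<dots> = (2 * real j) ^ j * exp (- c) ^ j / real n ^ j / real n ^ j"
      using j unfolding exp_diff exp_add nj by (simp only: exp_of_nat_mult) simp
    finally have "walk_bound n j ^ (2 * t) \<le> (2 * real j) ^ j * exp (- c) ^ j / real n ^ j / real n ^ j"
      using True by (simp add: walk_bound_def y_def)
    then have "walk_bound n j ^ (2 * t) * ((real (n choose j))\<^sup>2 * fact j)
        \<le> (2 * real j) ^ j * exp (- c) ^ j / real n ^ j / real n ^ j * ((real n ^ j)\<^sup>2 / fact j)"
    proof (rule mult_mono)
      have "(real (n choose j) * fact j)\<^sup>2 \<le> (real n ^ j)\<^sup>2" using cb by (intro power_mono) auto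
      then show "(real (n choose j))\<^sup>2 * fact j \<le> (real n ^ j)\<^sup>2 / fact j"
        by (simp add: field_simps power2_eq_square)
    qed auto
    also have "\<dots> = 2 ^ j * exp (- c) ^ j * (real j ^ j / fact j)"
      using n2 by (simp add: field_simps power2_eq_square)
    also have "\<dots> \<le> 2 ^ j * exp (- c) ^ j * exp (real j)"
      using power_le_exp_fact[of j] by (intro mult_left_mono) (auto simp: field_simps)
    also have "exp (real j) = exp 1 ^ j" using exp_of_nat_mult[of j "1::real"] by simp
    also have "2 ^ j * exp (- c) ^ j * exp 1 ^ j = (2 * exp (- c) * exp 1) ^ j"
      by (simp add: power_mult_distrib)
    also have "\<dots> \<le> (6 * exp (- c)) ^ j"
      using exp_le by (intro power_mono) auto
    finally show ?thesis .
  next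
    case False
    define y where "y = real j / (2 * (real n - 1))"
    have y0: "0 \<le> y" using n2 by (simp add: y_def)
    have y1: "0 \<le> 1 - y" using j n2 by (simp add: y_def field_simps)
    have "2 * real t * y \<ge> 2 * (real n * (ln (real n) + c)) * y"
      using t y0 by (intro mult_right_mono) (auto simp: algebra_simps)
    moreover have "2 * (real n * (ln (real n) + c)) * y
        = (real j * (ln (real n) + c)) * (real n / (real n - 1))"
      using n2 by (simp add: y_def field_simps)
    moreover have "(real j * (ln (real n) + c)) * (real n / (real n - 1)) \<ge> (real j * (ln (real n) + c)) * 1"
      using n2 c lnn by (intro mult_left_mono) auto
    ultimately have "2 * real t * y \<ge> real j * ln (real n) + real j * c"
      by (simp add: algebra_simps)
    then have "- (2 * real t * y) \<le> real j * (- c) - real j * ln (real n)"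
      by simp
    then have "(1 - y) ^ (2 * t) \<le> exp (real j * (- c) - real j * ln (real n))"
      using expbd[OF y1] by (meson exp_le_cancel_iff order_trans)
    also have "\<dots> = exp (- c) ^ j / real n ^ j"
      unfolding exp_diff nj by (simp only: exp_of_nat_mult)
    finally have "walk_bound n j ^ (2 * t) \<le> exp (- c) ^ j / real n ^ j"
      using False by (simp add: walk_bound_def y_def)
    then have "walk_bound n j ^ (2 * t) * ((real (n choose j))\<^sup>2 * fact j)
        \<le> exp (- c) ^ j / real n ^ j * (4 ^ j * real n ^ j)"
    proof (rule mult_mono)
      have "n choose j \<le> 2 ^ n" by (rule binomial_le_pow2)
      then have "real (n choose j) \<le> 2 ^ n" by (metis of_nat_le_iff of_nat_numeral of_nat_power)
      also have "(2::real) ^ n \<le> 2 ^ (2 * j)" using False by (intro power_increasing) auto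
      also have "\<dots> = 4 ^ j" by (simp add: power_mult)
      finally have "real (n choose j) * (real (n choose j) * fact j) \<le> 4 ^ j * real n ^ j"
        using cb by (intro mult_mono) auto
      then show "(real (n choose j))\<^sup>2 * fact j \<le> 4 ^ j * real n ^ j"
        by (simp add: power2_eq_square mult.assoc)
    qed auto
    also have "\<dots> = (4 * exp (- c)) ^ j" using n2 by (simp add: power_mult_distrib)
    also have "\<dots> \<le> (6 * exp (- c)) ^ j" by (intro power_mono) auto
    finally show ?thesis .
  qed
qed

section \<open>Square norm of the distribution after \<open>t\<close> steps\<close>

lemma sum_Pow_card:
  assumes "finite W"
  shows "(\<Sum>A\<in>Pow W - {{}}. h (card A)) = (\<Sum>m=1..card W. real (card W choose m) * h m)"
proof -
  have group: "(\<Sum>m=1..card W. \<Sum>A\<in>{A \<in> Pow W - {{}}. card A = m}. h (card A)) = (\<Sum>A\<in>Pow W - {{}}. h (card A))"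
  proof (rule sum.group)
    show "card ` (Pow W - {{}}) \<subseteq> {1..card W}"
    proof
      fix m assume "m \<in> card ` (Pow W - {{}})"
      then obtain A where A: "A \<subseteq> W" "A \<noteq> {}" "m = card A" by auto
      then have "card A > 0" using finite_subset[OF A(1) assms] by (simp add: card_gt_0_iff)
      then show "m \<in> {1..card W}" using card_mono[OF assms A(1)] A(3) by simp
    qed
  qed (use assms in auto)
  have "(\<Sum>A\<in>{A \<in> Pow W - {{}}. card A = m}. h (card A)) = real (card W choose m) * h m"
    if "m \<in> {1..card W}" for m
  proof -
    have "{A \<in> Pow W - {{}}. card A = m} = {A. A \<subseteq> W \<and> card A = m}" using that by auto
    then show ?thesis using n_subsets[OF assms, of m] by simp
  qed
  then show ?thesis unfolding group[symmetric] by (intro sum.cong refl)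
qed

definition point_mass :: "('a \<Rightarrow> 'a) \<Rightarrow> real" where
  "point_mass = (\<lambda>x. of_bool (x = id))"

lemma ip_point_mass:
  assumes "finite W" shows "ip (perms W) f point_mass = f id"
proof -
  have "ip (perms W) f point_mass = (\<Sum>x\<in>perms W. if x = id then f x else 0)"
    unfolding ip_def point_mass_def by (intro sum.cong) auto
  also have "\<dots> = f id" using assms permutes_id[of W] by (simp add: finite_permutations)
  finally show ?thesis .
qed

lemma average_point_mass_id:
  assumes "finite A" shows "average A point_mass id = 1 / fact (card A)"
proof -
  have "(\<Sum>h\<in>perms A. point_mass h) = (\<Sum>h\<in>perms A. if h = id then 1 else 0)"
    by (intro sum.cong) (auto simp: point_mass_def)
  also have "\<dots> = (1::real)" using assms permutes_id[of A] by (simp add: finite_permutations)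
  finally show ?thesis by (simp add: average_def)
qed

lemma walk_const:
  assumes "2 \<le> card W" shows "walk W (\<lambda>_. c) = (\<lambda>_. c)"
  using assms by (auto simp: walk_def swaps_def fun_eq_iff field_simps)

lemma walk_funpow_const:
  assumes "2 \<le> card W" shows "(walk W ^^ t) (\<lambda>_. c) = (\<lambda>_. c)"
  by (induction t) (simp_all add: walk_const[OF assms])

text \<open>By self-adjointness the square norm is a diagonal entry of \<open>P^(2 t)\<close>, so
  the operator inequality applies, with \<open>1 / fact (card A)\<close> as diagonal entry of the
  average over \<open>A\<close>. The index is \<open>j = n - card A\<close>.\<close>

lemma walk_l2_le:
  fixes W :: "'a set" and t :: nat
  assumes W: "finite W" "2 \<le> card W"
  defines "\<mu> \<equiv> (walk W ^^ t) point_mass"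
  shows "fact (card W) * ip (perms W) \<mu> \<mu> - 1
    \<le> (\<Sum>j=1..<card W. walk_bound (card W) j ^ (2 * t) * ((real (card W choose j))\<^sup>2 * fact j))"
proof -
  define n where "n = card W"
  define w where "w j = walk_bound n j ^ (2 * t)" for j
  have n: "n \<ge> 2" using W by (simp add: n_def)
  have supp: "supported (perms W) (point_mass :: ('a \<Rightarrow> 'a) \<Rightarrow> real)"
    using permutes_id[of W] by (auto simp: supported_def point_mass_def)
  have "ip (perms W) \<mu> \<mu> = ip (perms W) ((walk W ^^ (2 * t)) point_mass) point_mass"
    using W(2) ip_walk_funpow[of W t \<mu> point_mass]
    by (simp add: \<mu>_def mult_2 funpow_add ip_commute)
  also have "\<dots> \<le> (\<Sum>A\<in>Pow W - {{}}. w (n - card A) * ip (perms W) (average A point_mass) point_mass)"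
    unfolding w_def n_def by (rule walk_even_power_le_averages[OF W supp])
  also have "\<dots> = (\<Sum>A\<in>Pow W - {{}}. w (n - card A) * (1 / fact (card A)))"
    by (intro sum.cong) (auto simp: ip_point_mass[OF W(1)] average_point_mass_id finite_subset[OF _ W(1)])
  also have "\<dots> = (\<Sum>m=1..n. real (n choose m) * (w (n - m) * (1 / fact m)))"
    unfolding n_def by (rule sum_Pow_card[OF W(1)])
  also have "\<dots> = (\<Sum>j<n. real (n choose j) * (w j * (1 / fact (n - j))))"
    by (rule sum.reindex_bij_witness[of _ "\<lambda>j. n - j" "\<lambda>m. n - m"])
      (auto simp: binomial_symmetric[symmetric])
  finally have "fact n * ip (perms W) \<mu> \<mu> \<le> fact n * (\<Sum>j<n. real (n choose j) * (w j * (1 / fact (n - j))))"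
    by (intro mult_left_mono) auto
  also have "\<dots> = (\<Sum>j<n. fact n * (real (n choose j) * (w j * (1 / fact (n - j)))))"
    by (rule sum_distrib_left)
  also have "\<dots> = (\<Sum>j<n. w j * ((real (n choose j))\<^sup>2 * fact j))"
  proof (rule sum.cong[OF refl])
    fix j assume "j \<in> {..<n}"
    then have b: "real (n choose j) = fact n / (fact j * fact (n - j))"
      by (intro binomial_fact) simp
    show "fact n * (real (n choose j) * (w j * (1 / fact (n - j)))) = w j * ((real (n choose j))\<^sup>2 * fact j)"
      unfolding b by (simp add: power2_eq_square mult_ac)
  qed
  \<comment> \<open>The term \<open>j = 0\<close>, from \<open>A = W\<close>, equals 1: it is the
    stationary part subtracted in the claim.\<close>
  also have "{..<n} = insert 0 {1..<n}" using n by auto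
  also have "(\<Sum>j\<in>insert 0 {1..<n}. w j * ((real (n choose j))\<^sup>2 * fact j))
      = 1 + (\<Sum>j=1..<n. w j * ((real (n choose j))\<^sup>2 * fact j))"
    by (subst sum.insert) (auto simp: w_def walk_bound_def)
  finally show ?thesis by (simp add: w_def n_def)
qed

text \<open>Cauchy-Schwarz for \<open>F\<close> against the deviation of \<open>\<mu>\<close> from
  uniform. The right side is the chi-square distance, since \<open>\<mu>\<close> has total mass
  1.\<close>

lemma walk_l2_distance:
  fixes W :: "'a set" and t :: nat
  assumes W: "finite W" "2 \<le> card W" and F: "\<And>x. 0 \<le> F x" "\<And>x. F x \<le> 1"
  defines "\<mu> \<equiv> (walk W ^^ t) point_mass"
  shows "((walk W ^^ t) F id - average W F id)\<^sup>2 \<le> fact (card W) * ip (perms W) \<mu> \<mu> - 1"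
proof -
  define N where "N = (fact (card W) :: real)"
  have N: "N > 0" by (simp add: N_def)
  have cG: "real (card (perms W)) = N" using W(1) by (simp add: card_permutations N_def)
  have "(walk W ^^ t) F id = ip (perms W) F \<mu>"
    using ip_point_mass[OF W(1), of "(walk W ^^ t) F"] ip_walk_funpow[of W t F point_mass] W(2)
    by (simp add: \<mu>_def)
  moreover have "average W F id = (\<Sum>x\<in>perms W. F x * (1 / N))"
    by (simp add: average_def N_def sum_divide_distrib)
  ultimately have eq: "(walk W ^^ t) F id - average W F id = (\<Sum>x\<in>perms W. F x * (\<mu> x - 1 / N))"
    by (simp add: ip_def sum_subtractf right_diff_distrib)
  have mass: "(\<Sum>x\<in>perms W. \<mu> x) = 1"
  proof -
    have "(\<Sum>x\<in>perms W. \<mu> x) = ip (perms W) (\<lambda>_. 1) \<mu>" by (simp add: ip_def)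
    also have "\<dots> = ip (perms W) (\<lambda>_. 1) point_mass"
      using ip_walk_funpow[of W t "\<lambda>_. 1" point_mass] walk_funpow_const[OF W(2), of t 1] W(2)
      by (simp add: \<mu>_def)
    finally show ?thesis by (simp add: ip_point_mass[OF W(1)])
  qed
  have "(\<Sum>x\<in>perms W. (\<mu> x - 1 / N)\<^sup>2) = (\<Sum>x\<in>perms W. \<mu> x * \<mu> x - 2 / N * \<mu> x + (1 / N)\<^sup>2)"
    by (intro sum.cong) (auto simp: power2_eq_square algebra_simps)
  also have "\<dots> = ip (perms W) \<mu> \<mu> - 2 / N * (\<Sum>x\<in>perms W. \<mu> x) + N * (1 / N)\<^sup>2"
    by (simp add: ip_def sum.distrib sum_subtractf sum_distrib_left[symmetric] sum_divide_distrib[symmetric] cG)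
  finally have var: "(\<Sum>x\<in>perms W. (\<mu> x - 1 / N)\<^sup>2) = ip (perms W) \<mu> \<mu> - 1 / N"
    using N by (simp add: mass power2_eq_square)
  have "((walk W ^^ t) F id - average W F id)\<^sup>2 \<le> (\<Sum>x\<in>perms W. (F x)\<^sup>2) * (\<Sum>x\<in>perms W. (\<mu> x - 1 / N)\<^sup>2)"
    unfolding eq by (rule Cauchy_Schwarz_ineq_sum)
  also have "\<dots> \<le> N * (\<Sum>x\<in>perms W. (\<mu> x - 1 / N)\<^sup>2)"
  proof (intro mult_right_mono sum_nonneg)
    have "(\<Sum>x\<in>perms W. (F x)\<^sup>2) \<le> (\<Sum>x\<in>perms W. 1)"
      using F by (intro sum_mono) (simp add: power_le_one)
    then show "(\<Sum>x\<in>perms W. (F x)\<^sup>2) \<le> N" using cG by simp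
  qed auto
  also have "\<dots> = N * ip (perms W) \<mu> \<mu> - 1" using N by (simp add: var right_diff_distrib)
  finally show ?thesis by (simp add: N_def)
qed

lemma walk_mixing_all:
  assumes W: "finite W" "2 \<le> card W" and F: "\<And>x. 0 \<le> F x" "\<And>x. F x \<le> 1"
    and c: "0 \<le> c" "6 * exp (- c) \<le> 1 / 2"
    and t: "real (card W) * ln (real (card W)) + c * real (card W) \<le> real t"
  shows "((walk W ^^ t) F id - average W F id)\<^sup>2 \<le> 12 * exp (- c)"
proof -
  define r where "r = 6 * exp (- c)"
  have r: "0 < r" "r \<le> 1 / 2" using c by (simp_all add: r_def)
  have "((walk W ^^ t) F id - average W F id)\<^sup>2
      \<le> (\<Sum>j=1..<card W. walk_bound (card W) j ^ (2 * t) * ((real (card W choose j))\<^sup>2 * fact j))"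
  proof (rule order_trans)
    show "((walk W ^^ t) F id - average W F id)\<^sup>2
        \<le> fact (card W) * ip (perms W) ((walk W ^^ t) point_mass) ((walk W ^^ t) point_mass) - 1"
      by (rule walk_l2_distance[OF W]) (rule F)+
  qed (rule walk_l2_le[OF W])
  also have "\<dots> \<le> (\<Sum>j=1..<card W. r ^ j)"
    unfolding r_def using walk_bound_term_le[OF _ _ c(1) t] by (intro sum_mono) auto
  also have "\<dots> = r * (\<Sum>j<card W - 1. r ^ j)"
    unfolding sum_distrib_left
    by (rule sum.reindex_bij_witness[of _ Suc "\<lambda>j. j - 1"]) (auto simp: power_eq_if)
  also have "(\<Sum>j<card W - 1. r ^ j) = (1 - r ^ (card W - 1)) / (1 - r)"
    using r by (subst sum_gp_strict) auto
  also have "r * \<dots> \<le> r * 2"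
  proof (intro mult_left_mono)
    have "1 - r ^ (card W - 1) \<le> 1" using r by simp
    also have "1 \<le> 2 * (1 - r)" using r by simp
    finally show "(1 - r ^ (card W - 1)) / (1 - r) \<le> 2" using r by (simp add: field_simps)
  qed (use r in auto)
  finally show ?thesis unfolding r_def by linarith
qed

section \<open>Marking particles and untouched particles\<close>

lemma average_nonneg: "(\<And>x. 0 \<le> f x) \<Longrightarrow> 0 \<le> average A f x"
  by (simp add: average_def sum_nonneg)

lemma average_le_1:
  assumes "finite A" "\<And>x. f x \<le> 1" shows "average A f x \<le> 1"
proof -
  have "(\<Sum>h\<in>perms A. f (x \<circ> h)) \<le> (\<Sum>h\<in>perms A. 1)" using assms(2) by (intro sum_mono) auto
  also have "\<dots> = fact (card A)" using assms(1) by (simp add: card_permutations)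
  finally show ?thesis by (simp add: average_def)
qed

text \<open>A supersolution of the death chain with rates \<open>s (n - s + 1) / (n (n - 1))\<close>; it solves the
  continuous version \<open>\<phi>' = \<phi> / (s (1 - s / n))\<close> up to a shift.\<close>

definition marking_bound :: "nat \<Rightarrow> nat \<Rightarrow> real" where
  "marking_bound n s = real n * real s / (real n - real s + 1)"

text \<open>The mean decrease, rate times difference of consecutive values, is at least
  \<open>s / (n - s + 1)\<close>, which is a fraction \<open>1 / n\<close> of the current
  value.\<close>

lemma marking_bound_step:
  assumes "2 \<le> n" "2 * s \<le> n"
  shows "(1 - real s * (real n - real s + 1) / (real n * (real n - 1))) * marking_bound n s
    + real s * (real n - real s + 1) / (real n * (real n - 1)) * marking_bound n (s - 1)
    \<le> (1 - 1 / real n) * marking_bound n s"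
proof (cases "s = 0")
  case True then show ?thesis by (simp add: marking_bound_def)
next
  case False
  define N S where "N = real n" and "S = real s"
  have S: "1 \<le> S" "2 * S \<le> N" and N: "2 \<le> N" and S1: "real (s - 1) = S - 1"
    using assms False by (auto simp: N_def S_def of_nat_diff)
  define d e where "d = N - S + 1" and "e = N - S + 2"
  have d: "d > 0" and e: "e > 0" using S N by (auto simp: d_def e_def)
  have "N * S / d - N * (S - 1) / e = N * (S * e - (S - 1) * d) / (d * e)"
    using d e by (simp add: field_simps)
  also have "S * e - (S - 1) * d = N + 1" by (simp add: d_def e_def algebra_simps)
  finally have "S * d / (N * (N - 1)) * (N * S / d - N * (S - 1) / e) = S * (N + 1) / ((N - 1) * e)"
    using d e N by (simp add: field_simps)
  also have "\<dots> \<ge> S / d"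
  proof -
    \<comment> \<open>Equivalent to \<open>2 * S \<le> N + 3\<close>, so this is where
      \<open>2 * s \<le> n\<close> enters.\<close>
    have "(N - 1) * e \<le> (N + 1) * d" using S by (simp add: d_def e_def algebra_simps)
    then have "S * ((N - 1) * e) \<le> S * ((N + 1) * d)" using S by (intro mult_left_mono) auto
    then show ?thesis using d e N by (simp add: field_simps)
  qed
  finally have "S * d / (N * (N - 1)) * (N * S / d - N * (S - 1) / e) \<ge> S / d" .
  then have "(1 - S * d / (N * (N - 1))) * (N * S / d) + S * d / (N * (N - 1)) * (N * (S - 1) / e)
      \<le> N * S / d - S / d"
    by (simp only: left_diff_distrib right_diff_distrib)
  also have "\<dots> = (1 - 1 / N) * (N * S / d)"
  proof -
    have "1 / N * (N * S / d) = S / d" using N by simp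
    then show ?thesis by (simp only: left_diff_distrib mult_1_left)
  qed
  also have "e = N - (S - 1) + 1" by (simp add: e_def)
  finally show ?thesis
    unfolding marking_bound_def S1 N_def[symmetric] S_def[symmetric] d_def .
qed

text \<open>\<open>swaps_average\<close> with the identities on \<open>W - A\<close> moved into the
  first coefficient. The three terms stand for no new mark, a mark on \<open>b\<close>, and an
  exchange of two unmarked particles.\<close>

lemma walk_average:
  assumes W: "finite W" "2 \<le> card W" and A: "A \<subseteq> W"
  defines "n \<equiv> real (card W)" and "s \<equiv> real (card (W - A))"
  shows "walk W (average A f) x = (1 / 2 + ((n - s)\<^sup>2 - s - n) / (2 * n * (n - 1))) * average A f x
    + ((n - s + 1) / (n * (n - 1)) * (\<Sum>b\<in>W - A. average (insert b A) f x)
    + 1 / (2 * n * (n - 1)) * (\<Sum>a\<in>W - A. \<Sum>b\<in>W - A - {a}. average A f (x \<circ> swp a b)))"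
proof -
  have cA: "real (card A) = n - s"
    using A W(1) finite_subset[OF A] by (simp add: n_def s_def card_Diff_subset card_mono of_nat_diff)
  have n: "n \<ge> 2" using W(2) by (simp add: n_def)
  have sw: "swaps W (average A f) x = ((n - s)\<^sup>2 - 2 * s) * average A f x
      + 2 * (n - s + 1) * (\<Sum>b\<in>W - A. average (insert b A) f x)
      + (s * average A f x + (\<Sum>a\<in>W - A. \<Sum>b\<in>W - A - {a}. average A f (x \<circ> swp a b)))"
    using swaps_average[OF W(1) A, of f x] swaps_off_diagonal[of "W - A" "average A f" x] W(1)
    by (simp add: cA s_def)
  define M where "M = 1 / (2 * n * (n - 1))"
  have "walk W (average A f) x = average A f x / 2 + (swaps W (average A f) x - n * average A f x) * M"
    by (simp add: walk_def M_def n_def)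
  also have "\<dots> = (1 / 2 + ((n - s)\<^sup>2 - s - n) * M) * average A f x
      + ((n - s + 1) * (2 * M) * (\<Sum>b\<in>W - A. average (insert b A) f x)
      + M * (\<Sum>a\<in>W - A. \<Sum>b\<in>W - A - {a}. average A f (x \<circ> swp a b)))"
    unfolding sw by (simp add: algebra_simps)
  also have "2 * M = 1 / (n * (n - 1))" by (simp add: M_def)
  finally show ?thesis by (simp only: M_def times_divide_eq_right mult_1_right)
qed

text \<open>Induction on time over all \<open>A\<close> and \<open>x\<close>:
  \<open>walk_average\<close> expands the first step into a convex combination of quantities covered
  by the induction hypothesis, and \<open>marking_bound_step\<close> supplies the factor
  \<open>1 - 1 / n\<close>.\<close>

lemma walk_mixing_marking:
  assumes W: "finite W" "2 \<le> card W" and f: "\<And>x. 0 \<le> f x" "\<And>x. f x \<le> 1"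
    and "A \<subseteq> W" "card W \<le> 2 * card A" "x permutes W"
  shows "\<bar>(walk W ^^ t) (average A f) x - average W f id\<bar>
    \<le> marking_bound (card W) (card (W - A)) * (1 - 1 / real (card W)) ^ t"
  using assms(5-)
proof (induction t arbitrary: A x)
  case (0 A x)
  have finA: "finite A" using 0(1) W(1) finite_subset by blast
  show ?case
  proof (cases "A = W")
    case True
    have "average W f x = average W f id"
      using fun_cong[OF translate_average[OF 0(3), of f], of id] by (simp only: translate_def id_comp)
    moreover have "marking_bound (card W) (card (W - W)) = 0" by (simp add: marking_bound_def)
    ultimately show ?thesis
      unfolding True funpow_0 by (simp only: diff_self abs_zero mult_zero_left order_refl)
  next
    case False
    then have "W - A \<noteq> {}" using 0(1) by blast
    then have s: "card (W - A) \<ge> 1" using W(1) by (simp add: Suc_le_eq card_gt_0_iff)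
    have "card (W - A) \<le> card W" using W(1) by (intro card_mono) auto
    moreover have "real (card W) * 1 \<le> real (card W) * real (card (W - A))"
      using s by (intro mult_left_mono) auto
    then have "real (card W) - real (card (W - A)) + 1 \<le> real (card W) * real (card (W - A))"
      using s by linarith
    \<comment> \<open>While a particle is unmarked the bound is at least 1, which covers any
      difference of values in the unit interval.\<close>
    ultimately have "1 \<le> marking_bound (card W) (card (W - A))"
      by (simp add: marking_bound_def le_divide_eq)
    moreover have "\<bar>average A f x - average W f id\<bar> \<le> 1"
      using average_nonneg[of f A x] average_nonneg[of f W id] average_le_1[OF finA, of f x] average_le_1[OF W(1), of f id] f
      by (simp add: abs_le_iff)
    ultimately show ?thesis unfolding funpow_0 power_0 mult_1_right by linarith
  qed
next
  case (Suc t A x)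
  define n s where "n = real (card W)" and "s = real (card (W - A))"
  define c where "c = average W f id"
  define L where "L = walk W ^^ t"
  define q where "q = (1 - 1 / n) ^ t"
  define \<alpha> \<beta> \<gamma> where "\<alpha> = 1 / 2 + ((n - s)\<^sup>2 - s - n) / (2 * n * (n - 1))"
    and "\<beta> = (n - s + 1) / (n * (n - 1))" and "\<gamma> = 1 / (2 * n * (n - 1))"
  have linL: "linop L" unfolding L_def by (rule linop_funpow[OF linop_walk])
  have finA: "finite A" and finE: "finite (W - A)" using Suc.prems(1) W(1) finite_subset by auto
  have n: "n \<ge> 2" using W(2) by (simp add: n_def)
  have cWA: "card (W - A) = card W - card A" "card A \<le> card W"
    using Suc.prems(1) W(1) finA by (simp_all add: card_Diff_subset card_mono)
  then have s: "0 \<le> s" "2 * s \<le> n" using Suc.prems(2) by (auto simp: s_def n_def)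
  have \<beta>: "\<beta> \<ge> 0" and \<gamma>: "\<gamma> \<ge> 0" using n s by (auto simp: \<beta>_def \<gamma>_def)
  have \<alpha>: "\<alpha> \<ge> 0"
  proof -
    have "s * 1 \<le> (n - s) * (n - s)" using s n by (intro mult_mono) auto
    moreover have "0 \<le> n * (n - 2)" using n by simp
    ultimately have "0 \<le> n * (n - 1) + ((n - s)\<^sup>2 - s - n)"
      by (simp add: power2_eq_square algebra_simps)
    moreover have "\<alpha> = (n * (n - 1) + ((n - s)\<^sup>2 - s - n)) / (2 * n * (n - 1))"
      using n by (simp add: \<alpha>_def field_simps)
    ultimately show ?thesis using n by simp
  qed
  \<comment> \<open>The coefficients are probabilities: there are \<open>s\<close> choices of
    \<open>b\<close> and \<open>s * (s - 1)\<close> ordered pairs of unmarked particles.\<close>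
  have total: "\<alpha> + (\<beta> * s + \<gamma> * (s * (s - 1))) = 1"
  proof -
    have \<gamma>1: "n * (n - 1) * \<gamma> = 1 / 2" using n by (simp add: \<gamma>_def)
    have "2 * \<gamma> = 1 / (n * (n - 1))" by (simp add: \<gamma>_def)
    then have \<beta>': "\<beta> = (n - s + 1) * (2 * \<gamma>)" by (simp add: \<beta>_def)
    have \<alpha>': "\<alpha> = 1 / 2 + ((n - s)\<^sup>2 - s - n) * \<gamma>"
      by (simp add: \<alpha>_def \<gamma>_def)
    have "\<alpha> + (\<beta> * s + \<gamma> * (s * (s - 1))) = 1 / 2 + n * (n - 1) * \<gamma>"
      unfolding \<alpha>' \<beta>' by (simp add: algebra_simps power2_eq_square)
    then show ?thesis using \<gamma>1 by simp
  qed
  have cE: "(\<Sum>a\<in>W - A. real (card (W - A - {a}))) = s * (s - 1)"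
  proof -
    have "real (card (W - A - {a})) = s - 1" if "a \<in> W - A" for a
      using card.remove[OF finE that] by (simp add: s_def)
    then have "(\<Sum>a\<in>W - A. real (card (W - A - {a}))) = (\<Sum>a\<in>W - A. s - 1)"
      by (intro sum.cong) auto
    then show ?thesis by (simp add: s_def)
  qed
  have "walk W (average A f) = (\<lambda>x. \<alpha> * average A f x + (\<beta> * (\<Sum>b\<in>W - A. 1 * average (insert b A) f x)
      + \<gamma> * (\<Sum>a\<in>W - A. 1 * (\<Sum>b\<in>W - A - {a}. 1 * translate (swp a b) (average A f) x))))"
    using walk_average[OF W Suc.prems(1), of f]
    by (simp add: \<alpha>_def \<beta>_def \<gamma>_def n_def s_def translate_def fun_eq_iff)
  then have "L (walk W (average A f)) = (\<lambda>x. \<alpha> * L (average A f) x + (\<beta> * (\<Sum>b\<in>W - A. 1 * L (average (insert b A) f) x)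
      + \<gamma> * (\<Sum>a\<in>W - A. 1 * (\<Sum>b\<in>W - A - {a}. 1 * L (translate (swp a b) (average A f)) x))))"
    by (simp only: linopD[OF linL] linop_scale[OF linL] linop_sum[OF linL])
  moreover have "L (translate (swp a b) (average A f)) x = L (average A f) (x \<circ> swp a b)" if "a \<in> W - A" "b \<in> W - A" for a b
    using walk_funpow_translate[OF permutes_swap_id[of a W b], of t "average A f"] that by (simp add: L_def translate_def)
  ultimately have "L (walk W (average A f)) x = \<alpha> * L (average A f) x + (\<beta> * (\<Sum>b\<in>W - A. L (average (insert b A) f) x)
      + \<gamma> * (\<Sum>a\<in>W - A. \<Sum>b\<in>W - A - {a}. L (average A f) (x \<circ> swp a b)))"
    by simp
  moreover have "c = \<alpha> * c + (\<beta> * (\<Sum>b\<in>W - A. c) + \<gamma> * (\<Sum>a\<in>W - A. \<Sum>b\<in>W - A - {a}. c))"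
  proof -
    have "(\<Sum>a\<in>W - A. \<Sum>b\<in>W - A - {a}. c) = s * (s - 1) * c"
      by (simp add: cE[symmetric] sum_distrib_right)
    moreover have "(\<Sum>b\<in>W - A. c) = s * c" by (simp add: s_def)
    ultimately have "\<alpha> * c + (\<beta> * (\<Sum>b\<in>W - A. c) + \<gamma> * (\<Sum>a\<in>W - A. \<Sum>b\<in>W - A - {a}. c))
        = \<alpha> * c + (\<beta> * (s * c) + \<gamma> * (s * (s - 1) * c))"
      by (simp only:)
    also have "\<dots> = (\<alpha> + (\<beta> * s + \<gamma> * (s * (s - 1)))) * c"
      by (simp add: algebra_simps)
    finally have "\<alpha> * c + (\<beta> * (\<Sum>b\<in>W - A. c) + \<gamma> * (\<Sum>a\<in>W - A. \<Sum>b\<in>W - A - {a}. c))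
        = (\<alpha> + (\<beta> * s + \<gamma> * (s * (s - 1)))) * c" .
    then show ?thesis by (simp add: total)
  qed
  ultimately have "L (walk W (average A f)) x - c = \<alpha> * (L (average A f) x - c) + (\<beta> * (\<Sum>b\<in>W - A. L (average (insert b A) f) x - c)
      + \<gamma> * (\<Sum>a\<in>W - A. \<Sum>b\<in>W - A - {a}. L (average A f) (x \<circ> swp a b) - c))"
    by (simp only: sum_subtractf right_diff_distrib)
  then have "\<bar>L (walk W (average A f)) x - c\<bar> \<le> \<alpha> * \<bar>L (average A f) x - c\<bar> + (\<beta> * \<bar>\<Sum>b\<in>W - A. L (average (insert b A) f) x - c\<bar>
      + \<gamma> * \<bar>\<Sum>a\<in>W - A. \<Sum>b\<in>W - A - {a}. L (average A f) (x \<circ> swp a b) - c\<bar>)"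
    using \<alpha> \<beta> \<gamma> by (auto simp: abs_mult intro!: order_trans[OF abs_triangle_ineq] add_mono)
  also have "\<dots> \<le> \<alpha> * (marking_bound (card W) (card (W - A)) * q)
      + (\<beta> * (s * (marking_bound (card W) (card (W - A) - 1) * q))
      + \<gamma> * (s * (s - 1) * (marking_bound (card W) (card (W - A)) * q)))"
  proof (intro add_mono mult_left_mono \<alpha> \<beta> \<gamma>)
    have IH: "\<bar>L (average A f) y - c\<bar> \<le> marking_bound (card W) (card (W - A)) * q" if "y permutes W" for y
      unfolding L_def c_def q_def n_def by (rule Suc.IH[OF Suc.prems(1,2) that])
    show "\<bar>L (average A f) x - c\<bar> \<le> marking_bound (card W) (card (W - A)) * q" by (rule IH[OF Suc.prems(3)])
    have "\<bar>\<Sum>b\<in>W - A. L (average (insert b A) f) x - c\<bar> \<le> (\<Sum>b\<in>W - A. \<bar>L (average (insert b A) f) x - c\<bar>)"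
      by (rule sum_abs)
    also have "\<dots> \<le> (\<Sum>b\<in>W - A. marking_bound (card W) (card (W - A) - 1) * q)"
    proof (rule sum_mono)
      fix b assume b: "b \<in> W - A"
      have "W - insert b A = W - A - {b}" by auto
      then have "card (W - insert b A) = card (W - A) - 1" using b finE by simp
      moreover have "\<bar>L (average (insert b A) f) x - c\<bar> \<le> marking_bound (card W) (card (W - insert b A)) * q"
        unfolding L_def c_def q_def n_def
        by (rule Suc.IH) (use Suc.prems b finA in auto)
      ultimately show "\<bar>L (average (insert b A) f) x - c\<bar> \<le> marking_bound (card W) (card (W - A) - 1) * q"
        by (simp only:)
    qed
    finally show "\<bar>\<Sum>b\<in>W - A. L (average (insert b A) f) x - c\<bar> \<le> s * (marking_bound (card W) (card (W - A) - 1) * q)"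
      by (simp add: s_def)
    have "\<bar>\<Sum>a\<in>W - A. \<Sum>b\<in>W - A - {a}. L (average A f) (x \<circ> swp a b) - c\<bar>
        \<le> (\<Sum>a\<in>W - A. \<Sum>b\<in>W - A - {a}. \<bar>L (average A f) (x \<circ> swp a b) - c\<bar>)"
      by (intro order_trans[OF sum_abs] sum_mono sum_abs)
    also have "\<dots> \<le> (\<Sum>a\<in>W - A. \<Sum>b\<in>W - A - {a}. marking_bound (card W) (card (W - A)) * q)"
      using permutes_compose[OF permutes_swap_id Suc.prems(3)] by (intro sum_mono IH) auto
    also have "\<dots> = s * (s - 1) * (marking_bound (card W) (card (W - A)) * q)"
      unfolding cE[symmetric] sum_distrib_right by simp
    finally show "\<bar>\<Sum>a\<in>W - A. \<Sum>b\<in>W - A - {a}. L (average A f) (x \<circ> swp a b) - c\<bar>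
        \<le> s * (s - 1) * (marking_bound (card W) (card (W - A)) * q)" .
  qed
  also have "\<dots> = ((\<alpha> + \<gamma> * (s * (s - 1))) * marking_bound (card W) (card (W - A))
      + \<beta> * s * marking_bound (card W) (card (W - A) - 1)) * q"
    by (simp add: algebra_simps)
  also have "\<alpha> + \<gamma> * (s * (s - 1)) = 1 - s * (n - s + 1) / (n * (n - 1))"
    using total by (simp add: \<beta>_def algebra_simps)
  also have "\<beta> * s = s * (n - s + 1) / (n * (n - 1))" by (simp add: \<beta>_def)
  also have "((1 - s * (n - s + 1) / (n * (n - 1))) * marking_bound (card W) (card (W - A))
      + s * (n - s + 1) / (n * (n - 1)) * marking_bound (card W) (card (W - A) - 1)) * q
      \<le> (1 - 1 / n) * marking_bound (card W) (card (W - A)) * q"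
    unfolding n_def s_def
    using marking_bound_step[of "card W" "card (W - A)"] W(2) Suc.prems(2) cWA n
    by (intro mult_right_mono) (auto simp: q_def n_def)
  finally have "\<bar>L (walk W (average A f)) x - c\<bar> \<le> marking_bound (card W) (card (W - A)) * ((1 - 1 / n) * q)"
    by (simp only: mult_ac)
  then show ?case
    unfolding funpow_Suc_right o_apply power_Suc L_def c_def q_def n_def .
qed

section \<open>Left multiplication and untouched particles\<close>

text \<open>Conjugation by \<open>x\<close> turns left transpositions into right ones. Left
  multiplication swaps the contents of sites, as in the process; right multiplication acts on
  starting positions, as the averages do.\<close>

lemma swaps_left:
  assumes "x permutes W"
  shows "swaps W f x = (\<Sum>a\<in>W. \<Sum>b\<in>W. f (swp a b \<circ> x))"
proof -
  have "(\<Sum>a\<in>W. \<Sum>b\<in>W. f (swp a b \<circ> x)) = (\<Sum>a\<in>W. \<Sum>b\<in>W. f (x \<circ> swp (inv x a) (inv x b)))"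
    by (simp add: transpose_comp_eq[OF permutes_bij[OF assms]])
  also have "\<dots> = (\<Sum>a\<in>W. \<Sum>b\<in>W. f (x \<circ> swp (inv x a) b))"
    using sum.permute[OF permutes_inv[OF assms], of "\<lambda>b. f (x \<circ> swp z b)" for z]
    by (simp add: comp_def)
  also have "\<dots> = (\<Sum>a\<in>W. \<Sum>b\<in>W. f (x \<circ> swp a b))"
    using sum.permute[OF permutes_inv[OF assms], of "\<lambda>a. \<Sum>b\<in>W. f (x \<circ> swp a b)"]
    by (simp add: comp_def)
  finally show ?thesis by (simp add: swaps_def)
qed

lemma walk_left:
  assumes W: "finite W" "2 \<le> card W" and x: "x permutes W"
  shows "walk W f x = f x / 2
    + (\<Sum>a\<in>W. \<Sum>b\<in>W - {a}. f (swp a b \<circ> x)) / (2 * real (card W) * (real (card W) - 1))"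
proof -
  have "(\<Sum>b\<in>W. f (swp a b \<circ> x)) = f x + (\<Sum>b\<in>W - {a}. f (swp a b \<circ> x))" if "a \<in> W" for a
    using W(1) that by (subst sum.remove[of _ a]) auto
  then have "swaps W f x = (\<Sum>a\<in>W. f x + (\<Sum>b\<in>W - {a}. f (swp a b \<circ> x)))"
    unfolding swaps_left[OF x] by (intro sum.cong) auto
  then show ?thesis by (simp add: walk_def sum.distrib)
qed

text \<open>Ordered pairs are counted by how many members lie in \<open>S\<close>. The arguments of
  \<open>g\<close> are real, so nothing is truncated for small \<open>s\<close>; terms with negative
  argument have coefficient zero.\<close>

lemma sum_card_Diff_pair:
  fixes g :: "real \<Rightarrow> real"
  assumes W: "finite W" and S: "S \<subseteq> W"
  defines "n \<equiv> real (card W)" and "s \<equiv> real (card S)"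
  shows "(\<Sum>a\<in>W. \<Sum>b\<in>W - {a}. g (real (card (S - {a, b}))))
    = s * ((s - 1) * g (s - 2) + (n - s) * g (s - 1)) + (n - s) * (s * g (s - 1) + (n - s - 1) * g s)"
proof -
  have fin: "finite S" "finite (W - S)" using W S finite_subset by auto
  have cWS: "real (card (W - S)) = n - s"
    using W S fin by (simp add: n_def s_def card_Diff_subset card_mono of_nat_diff)
  have c: "real (card (S - {a, b})) = s - of_bool (a \<in> S) - of_bool (b \<in> S)" if "a \<noteq> b" for a b
  proof -
    have "card (S \<inter> {a, b}) \<le> card S" using fin by (intro card_mono) auto
    moreover have "S \<inter> {a, b} = (if a \<in> S then {a} else {}) \<union> (if b \<in> S then {b} else {})" by auto
    ultimately show ?thesis
      using that fin by (simp add: card_Diff_subset_Int s_def of_nat_diff)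
  qed
  have inS: "(\<Sum>b\<in>W - {a}. g (real (card (S - {a, b})))) = (s - 1) * g (s - 2) + (n - s) * g (s - 1)"
    if a: "a \<in> S" for a
  proof -
    have c1: "real (card (S - {a})) = s - 1"
      using card.remove[OF fin(1) a] by (simp add: s_def)
    have "W - {a} = (S - {a}) \<union> (W - S)" using a S by auto
    then have "(\<Sum>b\<in>W - {a}. g (real (card (S - {a, b}))))
        = (\<Sum>b\<in>S - {a}. g (real (card (S - {a, b})))) + (\<Sum>b\<in>W - S. g (real (card (S - {a, b}))))"
      using fin by (simp only:) (rule sum.union_disjoint, auto)
    also have "(\<Sum>b\<in>S - {a}. g (real (card (S - {a, b})))) = (\<Sum>b\<in>S - {a}. g (s - 2))"
      using a by (intro sum.cong refl) (subst c, auto)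
    also have "(\<Sum>b\<in>W - S. g (real (card (S - {a, b})))) = (\<Sum>b\<in>W - S. g (s - 1))"
      using a by (intro sum.cong refl) (subst c, auto)
    finally show ?thesis using c1 by (simp add: cWS)
  qed
  have outS: "(\<Sum>b\<in>W - {a}. g (real (card (S - {a, b})))) = s * g (s - 1) + (n - s - 1) * g s"
    if a: "a \<in> W - S" for a
  proof -
    have c1: "real (card (W - S - {a})) = n - s - 1"
      using card.remove[OF fin(2) a] cWS by simp
    have "W - {a} = S \<union> (W - S - {a})" using a S by auto
    then have "(\<Sum>b\<in>W - {a}. g (real (card (S - {a, b}))))
        = (\<Sum>b\<in>S. g (real (card (S - {a, b})))) + (\<Sum>b\<in>W - S - {a}. g (real (card (S - {a, b}))))"
      using fin by (simp only:) (rule sum.union_disjoint, auto)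
    also have "(\<Sum>b\<in>S. g (real (card (S - {a, b})))) = (\<Sum>b\<in>S. g (s - 1))"
      using a by (intro sum.cong refl) (subst c, auto)
    also have "(\<Sum>b\<in>W - S - {a}. g (real (card (S - {a, b})))) = (\<Sum>b\<in>W - S - {a}. g s)"
      using a by (intro sum.cong refl) (subst c, auto)
    finally show ?thesis using c1 by (simp add: s_def)
  qed
  have "(\<Sum>a\<in>W. \<Sum>b\<in>W - {a}. g (real (card (S - {a, b}))))
      = (\<Sum>a\<in>S. \<Sum>b\<in>W - {a}. g (real (card (S - {a, b})))) + (\<Sum>a\<in>W - S. \<Sum>b\<in>W - {a}. g (real (card (S - {a, b}))))"
    by (subst sum.subset_diff[OF S W]) (rule add.commute)
  also have "\<dots> = (\<Sum>a\<in>S. (s - 1) * g (s - 2) + (n - s) * g (s - 1)) + (\<Sum>a\<in>W - S. s * g (s - 1) + (n - s - 1) * g s)"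
    by (intro arg_cong2[where f = "(+)"] sum.cong refl inS outS)
  finally show ?thesis by (simp add: cWS s_def[symmetric])
qed

text \<open>\<open>S\<close> is the set of particles not touched so far. The indicator of \<open>a \<le> u\<close> is at least
  \<open>1 - (u - b)\<^sup>2 / (b - a)\<^sup>2\<close>, and the walk maps quadratic polynomials in \<open>card S\<close> to such polynomials.\<close>

lemma walk_untouched_lower:
  fixes a b :: real
  assumes W: "finite W" "2 \<le> card W" and K: "K \<subseteq> W" and ab: "0 \<le> a" "a < b"
    and "S \<subseteq> K" "x permutes W" "\<And>i. i \<in> S \<Longrightarrow> x i = i"
  defines "n \<equiv> real (card W)" and "s \<equiv> real (card S)"
  shows "(walk W ^^ t) (\<lambda>x. of_bool (a \<le> real (card {i \<in> K. x i = i}))) x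
    \<ge> 1 - (s * (s - 1) * (1 - (2 * n - 3) / (n * (n - 1))) ^ t + s * (1 - 1 / n) ^ t * (1 - 2 * b) + b\<^sup>2) / (b - a)\<^sup>2"
  using assms(6-8) unfolding s_def
proof (induction t arbitrary: S x)
  case (0 S x)
  have finK: "finite K" using K W(1) finite_subset by blast
  define s where "s = real (card S)"
  \<comment> \<open>At time 0 the numerator is the square in Chebyshev's inequality, split into
    \<open>s * (s - 1)\<close> and \<open>s\<close> because these decay at different rates.\<close>
  have eq: "s * (s - 1) + s * (1 - 2 * b) + b\<^sup>2 = (b - s)\<^sup>2"
    by (simp add: power2_eq_square algebra_simps)
  show ?case
  proof (cases "a \<le> real (card {i \<in> K. x i = i})")
    case True
    then show ?thesis using eq by (simp add: s_def)
  next
    case False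
    have "S \<subseteq> {i \<in> K. x i = i}" using 0 by auto
    then have "s \<le> real (card {i \<in> K. x i = i})" using finK by (simp add: s_def card_mono)
    then have "(b - a)\<^sup>2 \<le> (b - s)\<^sup>2" using False ab by (intro power_mono) auto
    then have "1 \<le> (b - s)\<^sup>2 / (b - a)\<^sup>2" using ab by simp
    then show ?thesis using eq False by (simp add: s_def)
  qed
next
  case (Suc t S x)
  define h where "h = (walk W ^^ t) (\<lambda>x. of_bool (a \<le> real (card {i \<in> K. x i = i})))"
  define A B where "A = (1 - (2 * n - 3) / (n * (n - 1))) ^ t" and "B = (1 - 1 / n) ^ t * (1 - 2 * b)"
  define g where "g u = 1 - (u * (u - 1) * A + u * B + b\<^sup>2) / (b - a)\<^sup>2" for u
  define s where "s = real (card S)"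
  have n: "n \<ge> 2" using W(2) by (simp add: n_def)
  have SW: "S \<subseteq> W" using Suc.prems(1) K by blast
  have IH: "h y \<ge> g (real (card T))" if "T \<subseteq> K" "y permutes W" "\<And>i. i \<in> T \<Longrightarrow> y i = i" for T y
    using Suc.IH[OF that] by (simp add: h_def g_def A_def B_def mult_ac)
  have "h x \<ge> g s" using IH[OF Suc.prems] by (simp add: s_def)
  moreover have "(\<Sum>a\<in>W. \<Sum>b\<in>W - {a}. h (swp a b \<circ> x)) \<ge> (\<Sum>a\<in>W. \<Sum>b\<in>W - {a}. g (real (card (S - {a, b}))))"
  proof (intro sum_mono IH)
    fix c d assume cd: "c \<in> W" "d \<in> W - {c}"
    show "S - {c, d} \<subseteq> K" using Suc.prems(1) by blast
    show "swp c d \<circ> x permutes W" using cd by (intro permutes_compose Suc.prems permutes_swap_id) auto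
    fix i assume "i \<in> S - {c, d}"
    then show "(swp c d \<circ> x) i = i" using Suc.prems(3)[of i] by simp
  qed
  ultimately have "walk W h x \<ge> g s / 2 + (\<Sum>a\<in>W. \<Sum>b\<in>W - {a}. g (real (card (S - {a, b})))) / (2 * n * (n - 1))"
    unfolding walk_left[OF W Suc.prems(2)] n_def[symmetric]
    using n by (intro add_mono divide_right_mono) auto
  also have "(\<Sum>a\<in>W. \<Sum>b\<in>W - {a}. g (real (card (S - {a, b}))))
      = s * ((s - 1) * g (s - 2) + (n - s) * g (s - 1)) + (n - s) * (s * g (s - 1) + (n - s - 1) * g s)"
    unfolding s_def n_def by (rule sum_card_Diff_pair[OF W(1) SW])
  \<comment> \<open>\<open>s * (s - 1)\<close> and \<open>s\<close> are eigenfunctions: the ordered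
    pairs avoiding two given particles number \<open>(n - 2) * (n - 3)\<close>, those avoiding one
    \<open>(n - 1) * (n - 2)\<close>.\<close>
  also have "\<dots> = n * (n - 1) - (s * (s - 1) * A * ((n - 2) * (n - 3)) + s * B * ((n - 1) * (n - 2)) + b\<^sup>2 * (n * (n - 1))) / (b - a)\<^sup>2"
  proof -
    define D where "D = 1 / (b - a)\<^sup>2"
    have gD: "g u = 1 - (u * (u - 1) * A + u * B + b\<^sup>2) * D" for u by (simp add: g_def D_def)
    have "s * ((s - 1) * g (s - 2) + (n - s) * g (s - 1)) + (n - s) * (s * g (s - 1) + (n - s - 1) * g s)
      = n * (n - 1) - (s * (s - 1) * A * ((n - 2) * (n - 3)) + s * B * ((n - 1) * (n - 2)) + b\<^sup>2 * (n * (n - 1))) * D"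
      unfolding gD by algebra
    then show ?thesis by (simp add: D_def)
  qed
  also have "g s / 2 + (n * (n - 1) - (s * (s - 1) * A * ((n - 2) * (n - 3)) + s * B * ((n - 1) * (n - 2)) + b\<^sup>2 * (n * (n - 1))) / (b - a)\<^sup>2) / (2 * n * (n - 1))
    = 1 - (s * (s - 1) * (A * (1 - (2 * n - 3) / (n * (n - 1)))) + s * (B * (1 - 1 / n)) + b\<^sup>2) / (b - a)\<^sup>2"
  proof -
    \<comment> \<open>With the idle half, these counts become the one-step survival probabilities of
      a pair and of a single particle.\<close>
    have e: "1 - (2 * n - 3) / (n * (n - 1)) = 1 / 2 + ((n - 2) * (n - 3)) / (2 * n * (n - 1))"
        "1 - 1 / n = 1 / 2 + ((n - 1) * (n - 2)) / (2 * n * (n - 1))"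
      using n by (simp_all add: field_simps)
    define D where "D = 1 / (b - a)\<^sup>2"
    define M where "M = 1 / (2 * n * (n - 1))"
    have M: "n * (n - 1) * M = 1 / 2" using n by (simp add: M_def)
    have "(1 - (s * (s - 1) * A + s * B + b\<^sup>2) * D) / 2 + (n * (n - 1) - (s * (s - 1) * A * ((n - 2) * (n - 3)) + s * B * ((n - 1) * (n - 2)) + b\<^sup>2 * (n * (n - 1))) * D) * M
      = 1 - (s * (s - 1) * (A * (1 / 2 + ((n - 2) * (n - 3)) * M)) + s * (B * (1 / 2 + ((n - 1) * (n - 2)) * M)) + b\<^sup>2) * D + (n * (n - 1) * M - 1 / 2) * (1 - b\<^sup>2 * D)"
      by (simp add: algebra_simps add_divide_distrib diff_divide_distrib)
    then show ?thesis unfolding M by (simp add: g_def e D_def M_def)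
  qed
  finally show ?case by (simp add: h_def A_def B_def s_def mult_ac)
qed

section \<open>The exclusion process as an image of the walk\<close>

lemma measure_bind_pmf_eq_integral:
  "measure_pmf.prob (bind_pmf M N) B = measure_pmf.expectation M (\<lambda>x. measure_pmf.prob (N x) B)"
proof -
  have int: "integrable M (\<lambda>x. measure_pmf.prob (N x) B)"
    by (rule measure_pmf.integrable_const_bound[where B = 1]) auto
  have "ennreal (measure_pmf.prob (bind_pmf M N) B) = (\<integral>\<^sup>+x. ennreal (measure_pmf.prob (N x) B) \<partial>M)"
    unfolding measure_pmf.emeasure_eq_measure[symmetric] by simp
  also have "\<dots> = ennreal (measure_pmf.expectation M (\<lambda>x. measure_pmf.prob (N x) B))"
    by (rule nn_integral_eq_integral[OF int]) simp
  finally show ?thesis by (subst (asm) ennreal_inj) (auto intro: integral_nonneg_AE)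
qed

text \<open>Peels off the first step instead of the last, since \<open>walk\<close> acts on
  functions of the starting point.\<close>

lemma steps_Suc_shift: "steps K (Suc t) x = bind_pmf (K x) (steps K t)"
proof (induction t)
  case 0
  show ?case by (simp add: bind_return_pmf bind_return_pmf')
next
  case (Suc t)
  have "steps K (Suc (Suc t)) x = bind_pmf (steps K (Suc t) x) K" by simp
  also have "\<dots> = bind_pmf (K x) (\<lambda>y. bind_pmf (steps K t y) K)"
    unfolding Suc by (rule bind_assoc_pmf)
  finally show ?case by simp
qed

section \<open>Identification of the process with the walk\<close>

lemma finite_complete_edges: "finite (complete_edges n)"
  by (rule finite_subset[of _ "{1..n} \<times> {1..n}"]) (auto simp: complete_edges_def)

lemma sum_ordered_pairs:
  fixes h :: "nat \<Rightarrow> nat \<Rightarrow> real"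
  assumes "\<And>a b. h a b = h b a"
  shows "(\<Sum>a\<in>{1..n}. \<Sum>b\<in>{1..n} - {a}. h a b) = 2 * (\<Sum>e\<in>complete_edges n. h (fst e) (snd e))"
proof -
  define E where "E = complete_edges n"
  have fin: "finite E" unfolding E_def by (rule finite_complete_edges)
  have S: "Sigma {1..n} (\<lambda>a. {1..n} - {a}) = E \<union> prod.swap ` E"
    by (auto simp: E_def complete_edges_def image_iff)
  have "(\<Sum>a\<in>{1..n}. \<Sum>b\<in>{1..n} - {a}. h a b)
      = (\<Sum>e\<in>Sigma {1..n} (\<lambda>a. {1..n} - {a}). h (fst e) (snd e))"
    by (subst sum.Sigma) (auto simp: case_prod_unfold)
  also have "\<dots> = (\<Sum>e\<in>E \<union> prod.swap ` E. h (fst e) (snd e))"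
    by (simp only: S)
  also have "\<dots> = (\<Sum>e\<in>E. h (fst e) (snd e)) + (\<Sum>e\<in>prod.swap ` E. h (fst e) (snd e))"
    using fin by (intro sum.union_disjoint) (auto simp: E_def complete_edges_def)
  also have "(\<Sum>e\<in>prod.swap ` E. h (fst e) (snd e)) = (\<Sum>e\<in>E. h (fst e) (snd e))"
    by (subst sum.reindex) (auto simp: assms[of "snd _" "fst _"])
  finally show ?thesis by (simp add: E_def)
qed

lemma card_complete_edges:
  assumes "1 \<le> n" shows "2 * real (card (complete_edges n)) = real n * (real n - 1)"
  using sum_ordered_pairs[of "\<lambda>_ _. 1" n] assms by (simp add: of_nat_diff)

text \<open>\<open>p\<close> moves sites, so the particle that started at \<open>x i\<close> is at
  \<open>p (x i)\<close>.\<close>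

definition place :: "nat \<Rightarrow> (nat \<Rightarrow> nat) \<Rightarrow> (nat \<Rightarrow> nat) \<Rightarrow> (nat \<Rightarrow> nat)" where
  "place k x p = restrict (p \<circ> x) {1..k}"

lemma swap_contents_place: "swap_contents k (a, b) (place k x p) = place k x (swp a b \<circ> p)"
  by (auto simp: swap_contents_def place_def)

text \<open>Conditioning on the first step yields the recursion \<open>walk_left\<close>; the
  induction ranges over all \<open>p\<close>, as a step changes \<open>p\<close> to
  \<open>swp a b \<circ> p\<close>.\<close>

lemma prob_steps_eq_walk:
  assumes n: "2 \<le> n" and p: "p permutes {1..n}"
  shows "measure_pmf.prob (steps (lazy_exclusion_step n k) t (place k x p)) B
    = (walk {1..n} ^^ t) (\<lambda>p. indicator B (place k x p)) p"
  using p
proof (induction t arbitrary: p)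
  case 0
  show ?case by (simp add: measure_return)
next
  case (Suc t p)
  let ?P = "\<lambda>y. measure_pmf.prob (steps (lazy_exclusion_step n k) t y) B"
  let ?E = "complete_edges n"
  define h where "h = (walk {1..n} ^^ t) (\<lambda>p. indicator B (place k x p) :: real)"
  have E: "finite ?E" "?E \<noteq> {}"
    using n finite_complete_edges[of n] card_complete_edges[of n] by auto
  have IH: "?P (place k x q) = h q" if "q permutes {1..n}" for q
    using Suc.IH[OF that] by (simp add: h_def)
  have "measure_pmf.prob (steps (lazy_exclusion_step n k) (Suc t) (place k x p)) B
    = measure_pmf.expectation (lazy_exclusion_step n k (place k x p)) ?P"
    unfolding steps_Suc_shift by (rule measure_bind_pmf_eq_integral)
  also have "\<dots> = ?P (place k x p) / 2 + (\<Sum>e\<in>?E. ?P (swap_contents k e (place k x p))) / (2 * real (card ?E))"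
  proof -
    define M where "M b = (if b then return_pmf (place k x p)
      else map_pmf (\<lambda>e. swap_contents k e (place k x p)) (pmf_of_set ?E))" for b
    have "measure_pmf.expectation (bind_pmf (bernoulli_pmf (1 / 2)) M) ?P
        = (\<Sum>b\<in>UNIV. pmf (bernoulli_pmf (1 / 2)) b *\<^sub>R measure_pmf.expectation (M b) ?P)"
      using E by (intro pmf_expectation_bind) (auto simp: M_def set_pmf_of_set)
    also have "\<dots> = ?P (place k x p) / 2 + (\<Sum>e\<in>?E. ?P (swap_contents k e (place k x p))) / (2 * real (card ?E))"
      using E by (simp add: UNIV_bool M_def integral_pmf_of_set)
    finally show ?thesis unfolding lazy_exclusion_step_def M_def .
  qed
  also have "(\<Sum>e\<in>?E. ?P (swap_contents k e (place k x p))) = (\<Sum>e\<in>?E. h (swp (fst e) (snd e) \<circ> p))"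
  proof (rule sum.cong[OF refl])
    fix e assume "e \<in> ?E"
    then have "swp (fst e) (snd e) \<circ> p permutes {1..n}"
      by (intro permutes_compose[OF Suc.prems] permutes_swap_id) (auto simp: complete_edges_def)
    then show "?P (swap_contents k e (place k x p)) = h (swp (fst e) (snd e) \<circ> p)"
      using IH swap_contents_place[of k "fst e" "snd e" x p] by simp
  qed
  also have "\<dots> = (\<Sum>a\<in>{1..n}. \<Sum>b\<in>{1..n} - {a}. h (swp a b \<circ> p)) / 2"
    using sum_ordered_pairs[of "\<lambda>a b. h (swp a b \<circ> p)" n] by (simp add: transpose_commute)
  also have "?P (place k x p) = h p" by (rule IH[OF Suc.prems])
  also have "2 * real (card ?E) = real n * (real n - 1)" using n by (intro card_complete_edges) simp
  also have "h p / 2 + (\<Sum>a\<in>{1..n}. \<Sum>b\<in>{1..n} - {a}. h (swp a b \<circ> p)) / 2 / (real n * (real n - 1))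
      = walk {1..n} h p"
    using n by (subst walk_left[OF _ _ Suc.prems]) auto
  finally show ?case by (simp add: h_def)
qed

section \<open>Placements and the uniform distribution\<close>

lemma placementsD:
  assumes "x \<in> placements n k"
  shows "inj_on x {1..k}" "x ` {1..k} \<subseteq> {1..n}" "x \<in> extensional {1..k}"
  using assms by (auto simp: placements_def PiE_def)

lemma finite_placements: "finite (placements n k)"
  unfolding placements_def by (intro finite_Collect_conjI disjI1) (simp add: finite_PiE)

lemma place_in_placements:
  assumes "x \<in> placements n k" "p permutes {1..n}"
  shows "place k x p \<in> placements n k"
proof -
  have "inj_on (p \<circ> x) {1..k}"
    using placementsD(1)[OF assms(1)] permutes_inj_on[OF assms(2)] by (rule comp_inj_on)
  moreover have "p (x i) \<in> {1..n}" if "i \<in> {1..k}" for i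
    using placementsD(2)[OF assms(1)] that permutes_in_image[OF assms(2)] by blast
  then have "restrict (p \<circ> x) {1..k} \<in> {1..k} \<rightarrow>\<^sub>E {1..n}" by (simp add: restrict_PiE)
  ultimately show ?thesis
    unfolding placements_def place_def by (simp add: inj_on_restrict_eq)
qed

lemma place_id: "x \<in> placements n k \<Longrightarrow> place k x id = x"
  using placementsD(3) by (auto simp: place_def extensional_restrict)

text \<open>Send \<open>x i\<close> to \<open>y i\<close> and match the empty sites, equally many,
  by any bijection.\<close>

lemma placements_transitive:
  assumes x: "x \<in> placements n k" and y: "y \<in> placements n k"
  obtains \<sigma> where "\<sigma> permutes {1..n}" "place k x \<sigma> = y"
proof -
  let ?K = "{1..k}" and ?W = "{1..n}"
  note X = placementsD[OF x] and Y = placementsD[OF y]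
  have "card (?W - x ` ?K) = card (?W - y ` ?K)"
    using X Y by (simp add: card_Diff_subset card_image)
  then obtain g where g: "bij_betw g (?W - x ` ?K) (?W - y ` ?K)"
    using finite_same_card_bij[of "?W - x ` ?K" "?W - y ` ?K"] by auto
  define \<sigma> where "\<sigma> v = (if v \<in> x ` ?K then y (inv_into ?K x v) else if v \<in> ?W then g v else v)" for v
  have "bij_betw (y \<circ> inv_into ?K x) (x ` ?K) (y ` ?K)"
    using X(1) Y(1) by (intro bij_betw_trans[of _ _ ?K]) (auto simp: bij_betw_inv_into inj_on_imp_bij_betw)
  then have 1: "bij_betw \<sigma> (x ` ?K) (y ` ?K)"
    by (rule bij_betw_cong[THEN iffD1, rotated]) (auto simp: \<sigma>_def)
  have 2: "bij_betw \<sigma> (?W - x ` ?K) (?W - y ` ?K)"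
    using g by (rule bij_betw_cong[THEN iffD1, rotated]) (auto simp: \<sigma>_def)
  have "bij_betw \<sigma> (x ` ?K \<union> (?W - x ` ?K)) (y ` ?K \<union> (?W - y ` ?K))"
    by (rule bij_betw_combine[OF 1 2]) auto
  moreover have "x ` ?K \<union> (?W - x ` ?K) = ?W" "y ` ?K \<union> (?W - y ` ?K) = ?W"
    using X(2) Y(2) by auto
  ultimately have "bij_betw \<sigma> ?W ?W" by simp
  then have "\<sigma> permutes ?W"
    using X(2) by (intro bij_imp_permutes) (auto simp: \<sigma>_def)
  moreover have "place k x \<sigma> = y"
  proof
    fix i show "place k x \<sigma> i = y i"
      using X(1) Y(3) by (cases "i \<in> ?K") (auto simp: place_def \<sigma>_def extensional_def)
  qed
  ultimately show ?thesis using that by blast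
qed

text \<open>The fibres of \<open>place k x\<close> have equal size, because left multiplication by a
  permutation carrying \<open>y\<close> to \<open>z\<close> embeds the fibre of \<open>y\<close>
  into that of \<open>z\<close>. So a uniform permutation induces a uniform placement.\<close>

lemma prob_uniform_eq_average:
  assumes x: "x \<in> placements n k"
  shows "measure_pmf.prob (pmf_of_set (placements n k)) B = average {1..n} (\<lambda>p. indicator B (place k x p)) id"
proof -
  let ?P = "placements n k" and ?G = "perms {1..n}"
  define fiber where "fiber y = {p \<in> ?G. place k x p = y}" for y
  have finG: "finite ?G" by (simp add: finite_permutations)
  have le: "card (fiber y) \<le> card (fiber z)" if y: "y \<in> ?P" and z: "z \<in> ?P" for y z
  proof -
    obtain \<sigma> where \<sigma>: "\<sigma> permutes {1..n}" "place k y \<sigma> = z" by (rule placements_transitive[OF y z])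
    have "(\<lambda>p. \<sigma> \<circ> p) ` fiber y \<subseteq> fiber z"
    proof
      fix q assume "q \<in> (\<lambda>p. \<sigma> \<circ> p) ` fiber y"
      then obtain p where p: "p permutes {1..n}" "place k x p = y" "q = \<sigma> \<circ> p" by (auto simp: fiber_def)
      have "place k x q = place k y \<sigma>" unfolding p(3) p(2)[symmetric] by (auto simp: place_def)
      then show "q \<in> fiber z" using p \<sigma> permutes_compose by (auto simp: fiber_def)
    qed
    moreover have "inj_on (\<lambda>p. \<sigma> \<circ> p) (fiber y)"
      using permutes_inj[OF \<sigma>(1)] by (auto simp: inj_on_def fun_eq_iff inj_def)
    ultimately show ?thesis using finG by (intro card_inj_on_le) (auto simp: fiber_def)
  qed
  define c where "c = real (card (fiber x))"
  have c: "real (card (fiber y)) = c" if "y \<in> ?P" for y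
    using le[OF that x] le[OF x that] by (simp add: c_def)
  have group: "(\<Sum>p\<in>?G. f (place k x p)) = c * (\<Sum>y\<in>?P. f y)" for f :: "(nat \<Rightarrow> nat) \<Rightarrow> real"
  proof -
    have "(\<Sum>p\<in>?G. f (place k x p)) = (\<Sum>y\<in>?P. \<Sum>p\<in>{p \<in> ?G. place k x p = y}. f (place k x p))"
      using finG finite_placements place_in_placements[OF x]
      by (intro sum.group[symmetric]) auto
    also have "\<dots> = (\<Sum>y\<in>?P. c * f y)"
      using c by (intro sum.cong) (auto simp: fiber_def)
    finally show ?thesis by (simp add: sum_distrib_left)
  qed
  have tot: "fact n = c * real (card ?P)"
    using group[of "\<lambda>_. 1"] by (simp add: card_permutations)
  then have "c > 0" "real (card ?P) > 0"
    using fact_gt_zero[of n, where 'a = real] by (auto simp: c_def zero_less_mult_iff)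
  have "average {1..n} (\<lambda>p. indicator B (place k x p)) id = (c * (\<Sum>y\<in>?P. indicator B y)) / fact n"
    unfolding average_def using group[of "indicator B"] by simp
  also have "\<dots> = real (card (?P \<inter> B)) / real (card ?P)"
    using \<open>c > 0\<close> finite_placements by (simp add: tot indicator_def sum.If_cases Int_def)
  finally show ?thesis
    using x finite_placements by (subst measure_pmf_of_set) auto
qed

text \<open>The event does not see permutations of the initially empty sites, so marking may start
  with all of them marked.\<close>

lemma average_place:
  "average ({1..n} - x ` {1..k}) (\<lambda>p. indicator B (place k x p)) = (\<lambda>p. indicator B (place k x p) :: real)"
proof (rule average_fixed)
  fix h assume h: "h permutes {1..n} - x ` {1..k}"
  have "place k x (p \<circ> h) = place k x p" for p
    using permutes_not_in[OF h] by (auto simp: place_def restrict_def)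
  then show "translate h (\<lambda>p. indicator B (place k x p)) = (\<lambda>p. indicator B (place k x p) :: real)"
    by (simp add: translate_def)
qed simp

lemma placements_nonempty: "k \<le> n \<Longrightarrow> restrict id {1..k} \<in> placements n k"
  by (auto simp: placements_def inj_on_def)

section \<open>Bounds on the total variation distance\<close>

lemma exclusion_distance_le:
  assumes n: "2 \<le> n" and k: "k \<le> n"
    and bd: "\<And>x B. x \<in> placements n k \<Longrightarrow>
      \<bar>(walk {1..n} ^^ t) (\<lambda>p. indicator B (place k x p)) id - average {1..n} (\<lambda>p. indicator B (place k x p)) id\<bar> \<le> d"
  shows "exclusion_distance n k t \<le> d"
  unfolding exclusion_distance_def
proof (rule Max.boundedI)
  show "finite ((\<lambda>x. total_variation (steps (lazy_exclusion_step n k) t x) (pmf_of_set (placements n k))) ` placements n k)"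
    using finite_placements by simp
  show "(\<lambda>x. total_variation (steps (lazy_exclusion_step n k) t x) (pmf_of_set (placements n k))) ` placements n k \<noteq> {}"
    using placements_nonempty[OF k] by auto
  fix v assume "v \<in> (\<lambda>x. total_variation (steps (lazy_exclusion_step n k) t x) (pmf_of_set (placements n k))) ` placements n k"
  then obtain x where x: "x \<in> placements n k"
    and v: "v = total_variation (steps (lazy_exclusion_step n k) t x) (pmf_of_set (placements n k))" by blast
  show "v \<le> d"
    unfolding v total_variation_def
  proof (rule cSUP_least)
    fix B
    show "\<bar>measure_pmf.prob (steps (lazy_exclusion_step n k) t x) B - measure_pmf.prob (pmf_of_set (placements n k)) B\<bar> \<le> d"
      using bd[OF x, of B] prob_steps_eq_walk[OF n permutes_id, of k t x B] prob_uniform_eq_average[OF x, of B]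
      by (simp only: place_id[OF x])
  qed simp
qed

lemma exclusion_distance_ge:
  assumes x: "x \<in> placements n k"
  shows "measure_pmf.prob (steps (lazy_exclusion_step n k) t x) B - measure_pmf.prob (pmf_of_set (placements n k)) B
    \<le> exclusion_distance n k t"
proof -
  have "measure_pmf.prob (steps (lazy_exclusion_step n k) t x) B - measure_pmf.prob (pmf_of_set (placements n k)) B
      \<le> \<bar>measure_pmf.prob (steps (lazy_exclusion_step n k) t x) B - measure_pmf.prob (pmf_of_set (placements n k)) B\<bar>"
    by simp
  also have "\<dots> \<le> total_variation (steps (lazy_exclusion_step n k) t x) (pmf_of_set (placements n k))"
    unfolding total_variation_def
  proof (rule cSUP_upper)
    show "bdd_above (range (\<lambda>A. \<bar>measure_pmf.prob (steps (lazy_exclusion_step n k) t x) A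
        - measure_pmf.prob (pmf_of_set (placements n k)) A\<bar>))"
    proof (rule bdd_aboveI2)
      fix A show "\<bar>measure_pmf.prob (steps (lazy_exclusion_step n k) t x) A
        - measure_pmf.prob (pmf_of_set (placements n k)) A\<bar> \<le> 1"
        using measure_pmf.prob_le_1[of "steps (lazy_exclusion_step n k) t x" A]
          measure_pmf.prob_le_1[of "pmf_of_set (placements n k)" A]
          measure_nonneg[of "measure_pmf (steps (lazy_exclusion_step n k) t x)" A]
          measure_nonneg[of "measure_pmf (pmf_of_set (placements n k))" A]
        unfolding abs_le_iff by linarith
    qed
  qed simp
  also have "\<dots> \<le> exclusion_distance n k t"
    unfolding exclusion_distance_def using x finite_placements by (intro Max_ge) auto
  finally show ?thesis .
qed

text \<open>Initially \<open>k\<close> sites are unmarked, at most half, so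
  \<open>marking_bound\<close> is at most \<open>2 * k\<close>; the time factor is at most
  \<open>exp (- t / n)\<close>, hence at most \<open>exp (- c) / k\<close>.\<close>

lemma exclusion_distance_le_marking:
  assumes n: "2 \<le> n" and k: "1 \<le> k" "2 * k \<le> n" and t: "real n * ln (real k) + c * real n \<le> real t"
  shows "exclusion_distance n k t \<le> 2 * exp (- c)"
proof (rule exclusion_distance_le)
  fix x B assume x: "x \<in> placements n k"
  define A where "A = {1..n} - x ` {1..k}"
  note X = placementsD[OF x]
  have WA: "{1..n} - A = x ` {1..k}" using X(2) by (auto simp: A_def)
  have cx: "card (x ` {1..k}) = k" using X(1) by (simp add: card_image)
  have cW: "card {1..n} = n" by simp
  have cA: "card A = n - k" using X cx by (simp add: A_def card_Diff_subset)
  have "\<bar>(walk {1..n} ^^ t) (average A (\<lambda>p. indicator B (place k x p))) id - average {1..n} (\<lambda>p. indicator B (place k x p)) id\<bar>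
    \<le> marking_bound (card {1..n}) (card ({1..n} - A)) * (1 - 1 / real (card {1..n})) ^ t"
    using n k cA by (intro walk_mixing_marking permutes_id) (auto simp: A_def)
  also have "\<dots> \<le> (2 * real k) * exp (- (ln (real k) + c))"
  proof (rule mult_mono)
    have "real n * real k \<le> real k * 2 * (real n - real k + 1)"
      using k mult_left_mono[of "real n" "2 * (real n - real k + 1)" "real k"] by simp
    then show "marking_bound (card {1..n}) (card ({1..n} - A)) \<le> 2 * real k"
      using k unfolding WA cx cW marking_bound_def by (simp add: divide_le_eq mult_ac)
    have "(1 - 1 / real n) ^ t \<le> exp (- (1 / real n)) ^ t"
      using n exp_ge_add_one_self[of "- (1 / real n)"] by (intro power_mono) auto
    also have "\<dots> = exp (- (real t / real n))" by (simp add: exp_of_nat_mult[symmetric])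
    also have "\<dots> \<le> exp (- (ln (real k) + c))"
      using t n by (simp add: field_simps)
    finally show "(1 - 1 / real (card {1..n})) ^ t \<le> exp (- (ln (real k) + c))" by simp
  qed (use n in auto)
  also have "- (ln (real k) + c) = - c - ln (real k)" by simp
  also have "2 * real k * exp (- c - ln (real k)) = 2 * exp (- c)"
    unfolding exp_diff using k by simp
  finally show "\<bar>(walk {1..n} ^^ t) (\<lambda>p. indicator B (place k x p)) id - average {1..n} (\<lambda>p. indicator B (place k x p)) id\<bar>
      \<le> 2 * exp (- c)"
    unfolding A_def average_place .
qed (use n k in auto)

lemma exclusion_distance_le_l2:
  assumes n: "2 \<le> n" and k: "k \<le> n" and c: "0 \<le> c" "6 * exp (- c) \<le> 1 / 2"
    and t: "real n * ln (real n) + c * real n \<le> real t"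
  shows "exclusion_distance n k t \<le> sqrt (12 * exp (- c))"
proof (rule exclusion_distance_le[OF n k])
  fix x B assume x: "x \<in> placements n k"
  show "\<bar>(walk {1..n} ^^ t) (\<lambda>p. indicator B (place k x p)) id - average {1..n} (\<lambda>p. indicator B (place k x p)) id\<bar>
      \<le> sqrt (12 * exp (- c))"
  proof -
    let ?f = "\<lambda>p. indicator B (place k x p) :: real"
    have "((walk {1..n} ^^ t) ?f id - average {1..n} ?f id)\<^sup>2 \<le> 12 * exp (- c)"
    proof (rule walk_mixing_all[OF _ _ _ _ c])
      show "real (card {1..n}) * ln (real (card {1..n})) + c * real (card {1..n}) \<le> real t"
        using t by simp
    qed (use n in \<open>simp_all add: indicator_def\<close>)
    then have "sqrt (((walk {1..n} ^^ t) ?f id - average {1..n} ?f id)\<^sup>2) \<le> sqrt (12 * exp (- c))"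
      by (rule real_sqrt_le_mono)
    then show ?thesis by (simp only: real_sqrt_abs)
  qed
qed

section \<open>The mixing time\<close>

lemma sum_card_fixed_points:
  assumes "K \<subseteq> {1..n}"
  shows "(\<Sum>p\<in>perms {1..n}. real (card {i \<in> K. p i = i})) = real (card K) * fact (n - 1)"
proof -
  have finK: "finite K" using assms finite_subset by blast
  have stab: "card {p \<in> perms {1..n}. p i = i} = fact (n - 1)" if "i \<in> K" for i
  proof -
    have i: "i \<in> {1..n}" using that assms by blast
    have "{p \<in> perms {1..n}. p i = i} = perms ({1..n} - {i})"
    proof (intro equalityI subsetI)
      fix p assume p: "p \<in> {p \<in> perms {1..n}. p i = i}"
      have "p permutes {1..n} - {i}"
        using p by (intro permutesI_bij) (auto intro: permutes_bij permutes_not_in)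
      then show "p \<in> perms ({1..n} - {i})" by simp
    next
      fix p assume p: "p \<in> perms ({1..n} - {i})"
      then show "p \<in> {p \<in> perms {1..n}. p i = i}"
        using permutes_subset[of p "{1..n} - {i}" "{1..n}"] permutes_not_in[of p "{1..n} - {i}" i] by auto
    qed
    then show ?thesis using i by (simp add: card_permutations)
  qed
  have "(\<Sum>p\<in>perms {1..n}. real (card {i \<in> K. p i = i})) = (\<Sum>p\<in>perms {1..n}. \<Sum>i\<in>K. of_bool (p i = i))"
    using finK by (simp add: Int_def)
  also have "\<dots> = (\<Sum>i\<in>K. \<Sum>p\<in>perms {1..n}. of_bool (p i = i))" by (rule sum.swap)
  also have "\<dots> = (\<Sum>i\<in>K. fact (n - 1))"
  proof (rule sum.cong[OF refl])
    fix i assume i: "i \<in> K"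
    have "(\<Sum>p\<in>perms {1..n}. of_bool (p i = i)) = real (card {p \<in> perms {1..n}. p i = i})"
      by (simp add: finite_permutations Int_def)
    then show "(\<Sum>p\<in>perms {1..n}. of_bool (p i = i)) = (fact (n - 1) :: real)"
      using stab[OF i] by simp
  qed
  finally show ?thesis by simp
qed

text \<open>Markov's inequality, the mean number of fixed points being \<open>k / n\<close>.\<close>

lemma average_many_fixed_points_le:
  fixes n k :: nat and a :: real
  assumes "1 \<le> k" "k \<le> n" "0 < a"
  shows "average {1..n} (\<lambda>p. of_bool (a \<le> real (card {i \<in> {1..k}. p i = i}))) id \<le> 1 / a"
proof -
  have "(\<Sum>p\<in>perms {1..n}. of_bool (a \<le> real (card {i \<in> {1..k}. p i = i})))
      \<le> (\<Sum>p\<in>perms {1..n}. real (card {i \<in> {1..k}. p i = i}) * (1 / a))"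
    using assms by (intro sum_mono) auto
  also have "\<dots> = real k * fact (n - 1) * (1 / a)"
    using sum_card_fixed_points[of "{1..k}" n] assms by (simp add: sum_divide_distrib[symmetric])
  also have "\<dots> \<le> real n * fact (n - 1) * (1 / a)"
    using assms by (intro mult_right_mono) auto
  also have "real n * fact (n - 1) = fact n" using assms by (simp add: fact_reduce)
  finally show ?thesis by (simp add: average_def divide_le_eq)
qed

text \<open>Per step, pair survival exceeds the square of single survival by exactly the factor
  \<open>1 + 1 / (n - 1)^3\<close>. As \<open>t \<le> n * ln n \<le> n * (n - 1)\<close>, these
  factors multiply to at most \<open>exp (4 / n)\<close>.\<close>

lemma pair_survival_le:
  assumes n: "2 \<le> n" and t: "real t \<le> real n * ln (real n)"
  shows "(1 - (2 * real n - 3) / (real n * (real n - 1))) ^ t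
    \<le> exp (4 / real n) * ((1 - 1 / real n) ^ t)\<^sup>2"
proof -
  define N where "N = real n"
  have N: "N \<ge> 2" using n by (simp add: N_def)
  have id: "1 - (2 * N - 3) / (N * (N - 1)) = (1 + 1 / (N - 1) ^ 3) * (1 - 1 / N)\<^sup>2"
  proof -
    have "N * (N\<^sup>2 - 3 * N + 3) = (N - 1) ^ 3 + 1"
      by (simp add: power2_eq_square power3_eq_cube algebra_simps)
    then have "1 + 1 / (N - 1) ^ 3 = N * (N\<^sup>2 - 3 * N + 3) / (N - 1) ^ 3"
      using N by (simp add: add_divide_distrib)
    moreover have "(1 - 1 / N)\<^sup>2 = (N - 1)\<^sup>2 / N\<^sup>2"
      using N by (simp add: diff_divide_distrib power_divide[symmetric])
    ultimately have "(1 + 1 / (N - 1) ^ 3) * (1 - 1 / N)\<^sup>2 = (N\<^sup>2 - 3 * N + 3) / (N * (N - 1))"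
      using N by (simp add: power2_eq_square power3_eq_cube)
    then show ?thesis using N by (simp add: field_simps power2_eq_square)
  qed
  have "(1 + 1 / (N - 1) ^ 3) ^ t \<le> exp (1 / (N - 1) ^ 3) ^ t"
    using N exp_ge_add_one_self[of "1 / (N - 1) ^ 3"] by (intro power_mono) auto
  also have "\<dots> = exp (real t / (N - 1) ^ 3)" by (simp add: exp_of_nat_mult[symmetric])
  also have "\<dots> \<le> exp (4 / N)"
  proof -
    have "real t \<le> N * (N - 1)"
    proof -
      have "N * ln N \<le> N * (N - 1)" using ln_le_minus_one[of N] N by (intro mult_left_mono) auto
      then show ?thesis using t unfolding N_def by linarith
    qed
    then have "real t / (N - 1) ^ 3 \<le> N * (N - 1) / (N - 1) ^ 3"
      using N by (intro divide_right_mono) auto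
    also have "\<dots> = N / (N - 1)\<^sup>2" using N by (simp add: power2_eq_square power3_eq_cube)
    also have "\<dots> \<le> 4 / N"
    proof -
      have "N * N \<le> (2 * (N - 1)) * (2 * (N - 1))" using N by (intro mult_mono) auto
      then show ?thesis using N by (simp add: field_simps power2_eq_square)
    qed
    finally show ?thesis by simp
  qed
  finally have "(1 + 1 / (N - 1) ^ 3) ^ t * ((1 - 1 / N)\<^sup>2) ^ t \<le> exp (4 / N) * ((1 - 1 / N)\<^sup>2) ^ t"
    by (intro mult_right_mono) auto
  then show ?thesis
    unfolding N_def[symmetric] id power_mult_distrib by (simp add: power_mult[symmetric] mult.commute)
qed

text \<open>The distinguishing event is that at least \<open>b / 2\<close> particles are at their
  starting sites: likely for the walk by Chebyshev, unlikely at stationarity by Markov.\<close>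

lemma exclusion_distance_ge_untouched:
  assumes n: "2 \<le> n" and k: "1 \<le> k" "k \<le> n" and C: "2 \<le> C"
    and t: "real t \<le> real n * ln (real k) - C * real n"
  shows "1 - 50 * exp (- C) \<le> exclusion_distance n k t"
proof -
  define N where "N = real n"
  define q where "q = (1 - 1 / N) ^ t"
  \<comment> \<open>The mean number of untouched particles, \<open>q\<close> being the survival
    probability of one.\<close>
  define b where "b = real k * q"
  define q2 where "q2 = (1 - (2 * N - 3) / (N * (N - 1))) ^ t"
  have N: "N \<ge> 2" using n by (simp add: N_def)
  have lnk: "C \<le> ln (real k)"
  proof -
    have "0 \<le> N * (ln (real k) - C)" using t by (simp add: N_def algebra_simps)
    then show ?thesis using N by (simp add: zero_le_mult_iff)
  qed
  have lnkn: "ln (real k) \<le> ln N" using k by (simp add: N_def)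
  have kC: "exp C \<le> real k" using lnk k by (simp add: ln_ge_iff)
  \<comment> \<open>From \<open>1 - 1 / N \<ge> exp (- 1 / (N - 1))\<close>; having
    \<open>N - 1\<close> instead of \<open>N\<close> costs at most 1 in the exponent, because
    \<open>ln k \<le> N - 1\<close>.\<close>
  have q: "exp (- (ln (real k) - C + 1)) \<le> q"
  proof -
    have q1: "exp (- (1 / (N - 1))) \<le> 1 - 1 / N"
    proof -
      have "1 + 1 / (N - 1) \<le> exp (1 / (N - 1))" by (rule exp_ge_add_one_self)
      moreover have "1 + 1 / (N - 1) = inverse (1 - 1 / N)" using N by (simp add: field_simps)
      ultimately have "inverse (exp (1 / (N - 1))) \<le> inverse (inverse (1 - 1 / N))"
        using N by (intro le_imp_inverse_le) auto
      then show ?thesis by (simp add: exp_minus)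
    qed
    have "real t / (N - 1) \<le> (N * (ln (real k) - C)) / (N - 1)"
      using t N by (intro divide_right_mono) (auto simp: N_def algebra_simps)
    also have "\<dots> = (ln (real k) - C) + (ln (real k) - C) / (N - 1)"
      using N by (simp add: field_simps)
    also have "(ln (real k) - C) / (N - 1) \<le> 1"
      using N lnkn ln_le_minus_one[of N] C by simp
    finally have "exp (- (ln (real k) - C + 1)) \<le> exp (- (real t / (N - 1)))" by simp
    also have "\<dots> = exp (- (1 / (N - 1))) ^ t" by (simp add: exp_of_nat_mult[symmetric])
    also have "\<dots> \<le> q" unfolding q_def using q1 by (intro power_mono) auto
    finally show ?thesis .
  qed
  have b: "exp (C - 1) \<le> b"
  proof -
    have "exp (C - 1) = real k * exp (- (ln (real k) - C + 1))"
      using k by (simp add: exp_diff exp_add exp_minus field_simps)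
    also have "\<dots> \<le> b" unfolding b_def using q by (intro mult_left_mono) auto
    finally show ?thesis .
  qed
  then have bpos: "b > 0" using exp_gt_zero[of "C - 1"] by linarith
  define F where "F = (\<lambda>p. of_bool (b / 2 \<le> real (card {i \<in> {1..k}. p i = i})) :: real)"
  have low: "1 - (real k * (real k - 1) * q2 + real k * q * (1 - 2 * b) + b\<^sup>2) / (b - b / 2)\<^sup>2
      \<le> (walk {1..n} ^^ t) F id"
    using walk_untouched_lower[of "{1..n}" "{1..k}" "b / 2" b "{1..k}" id t] n k bpos
    by (simp add: F_def q2_def q_def N_def permutes_id)
  \<comment> \<open>As \<open>real k * q = b\<close>, the squares of \<open>b\<close> cancel up to
    the excess of pair survival over independence.\<close>
  have num: "real k * (real k - 1) * q2 + real k * q * (1 - 2 * b) + b\<^sup>2 \<le> b\<^sup>2 * (8 * exp (- C)) + b"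
  proof -
    have "real n * ln (real k) \<le> real n * ln N" using lnkn by (intro mult_left_mono) auto
    moreover have "0 \<le> C * real n" using C by simp
    ultimately have "real t \<le> real n * ln (real n)"
      unfolding N_def using t by linarith
    then have "q2 \<le> exp (4 / N) * q\<^sup>2"
      using pair_survival_le[OF n, of t] by (simp add: q2_def q_def N_def)
    \<comment> \<open>\<open>exp C \<le> k \<le> n\<close> gives \<open>4 / N \<le> d\<close>, and
      \<open>C \<ge> 2\<close> gives \<open>d \<le> 1\<close>, so that
      \<open>exp d \<le> 1 + 2 * d\<close>.\<close>
    moreover have "exp (4 / N) \<le> 1 + 8 * exp (- C)"
    proof -
      define d where "d = 4 * exp (- C)"
      have "exp (2::real) \<ge> 4"
      proof -
        have "(2::real) * 2 \<le> exp 1 * exp 1" using exp_ge_add_one_self[of 1] by (intro mult_mono) auto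
        then show ?thesis by (simp add: exp_add[symmetric])
      qed
      then have "exp C \<ge> 4" using C by (meson exp_le_cancel_iff order_trans)
      then have d: "0 \<le> d" "d \<le> 1" by (auto simp: d_def exp_minus field_simps)
      have "4 / N \<le> 4 / exp C" using kC k by (intro divide_left_mono) (auto simp: N_def intro: order_trans)
      then have "exp (4 / N) \<le> exp d" by (simp add: d_def exp_minus field_simps)
      also have "\<dots> \<le> 1 + d + d\<^sup>2" using d by (rule exp_bound)
      also have "d\<^sup>2 \<le> d" using d by (simp add: power2_eq_square mult_left_le)
      finally show ?thesis by (simp add: d_def)
    qed
    then have "exp (4 / N) * q\<^sup>2 \<le> (1 + 8 * exp (- C)) * q\<^sup>2" by (intro mult_right_mono) auto
    ultimately have "q2 \<le> (1 + 8 * exp (- C)) * q\<^sup>2" by linarith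
    moreover have "real k * (real k - 1) * q2 \<le> (real k)\<^sup>2 * q2"
    proof (rule mult_right_mono)
      have "2 * N - 3 \<le> N * (N - 1)" using N zero_le_square[of "N - 3 / 2"] by (simp add: algebra_simps)
      then show "0 \<le> q2" unfolding q2_def using N by simp
    qed (simp add: power2_eq_square mult_left_mono)
    ultimately have "real k * (real k - 1) * q2 \<le> (real k)\<^sup>2 * ((1 + 8 * exp (- C)) * q\<^sup>2)"
      by (meson mult_left_mono order_trans zero_le_power2)
    also have "\<dots> = b\<^sup>2 + b\<^sup>2 * (8 * exp (- C))"
      by (simp add: b_def power_mult_distrib algebra_simps)
    finally show ?thesis
      unfolding b_def[symmetric] by (simp add: power2_eq_square algebra_simps)
  qed
  have "(real k * (real k - 1) * q2 + real k * q * (1 - 2 * b) + b\<^sup>2) / (b - b / 2)\<^sup>2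
      \<le> (b\<^sup>2 * (8 * exp (- C)) + b) / (b - b / 2)\<^sup>2"
    using num by (intro divide_right_mono) auto
  also have "\<dots> = 32 * exp (- C) + 4 / b"
    using bpos by (simp add: power2_eq_square field_simps)
  finally have walk: "1 - 32 * exp (- C) - 4 / b \<le> (walk {1..n} ^^ t) F id" using low by linarith
  have stat: "average {1..n} F id \<le> 2 / b"
    using average_many_fixed_points_le[OF k, of "b / 2"] bpos by (simp add: F_def)
  define x where "x = restrict id {1..k}"
  define B where "B = {y. b / 2 \<le> real (card {i \<in> {1..k}. y i = i})}"
  have x: "x \<in> placements n k" unfolding x_def by (rule placements_nonempty[OF k(2)])
  have "{i \<in> {1..k}. place k x p i = i} = {i \<in> {1..k}. p i = i}" for p
    by (auto simp: place_def x_def)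
  then have F: "(\<lambda>p. indicator B (place k x p)) = F"
    by (auto simp: F_def B_def indicator_def fun_eq_iff)
  have "(walk {1..n} ^^ t) F id - average {1..n} F id \<le> exclusion_distance n k t"
    using exclusion_distance_ge[OF x, of t B] prob_steps_eq_walk[OF n permutes_id, of k t x B]
      prob_uniform_eq_average[OF x, of B]
    by (simp only: place_id[OF x] F)
  \<comment> \<open>The constant 50 is 32 from the pair excess plus 18, a bound for
    \<open>6 * exp 1\<close>, from the errors \<open>4 / b\<close> and \<open>2 / b\<close> with
    \<open>b \<ge> exp (C - 1)\<close>.\<close>
  moreover have "6 / b \<le> 18 * exp (- C)"
  proof -
    have "6 / b \<le> 6 / exp (C - 1)" using b bpos by (intro divide_left_mono) auto
    also have "\<dots> = 6 * exp 1 * exp (- C)" by (simp add: exp_diff exp_minus field_simps)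
    also have "\<dots> \<le> 18 * exp (- C)" using exp_le by (intro mult_right_mono) auto
    finally show ?thesis .
  qed
  moreover have "6 / b = 4 / b + 2 / b" by (simp add: add_divide_distrib[symmetric])
  ultimately show ?thesis using walk stat by linarith
qed

section \<open>Bounds on the mixing time\<close>

lemma exclusion_mixing_time_ge:
  assumes "2 \<le> n" "1 \<le> k" "k \<le> n" "\<epsilon> < 1" and C: "2 \<le> C" "50 * exp (- C) \<le> 1 - \<epsilon>"
  shows "ereal (real n * ln (real k) - C * real n) \<le> exclusion_mixing_time n k \<epsilon>"
  unfolding exclusion_mixing_time_def
proof (rule INF_greatest)
  fix t assume t: "t \<in> {t. 0 < t \<and> exclusion_distance n k t < \<epsilon>}"
  show "ereal (real n * ln (real k) - C * real n) \<le> ereal (real t)"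
  proof (rule ccontr)
    assume "\<not> ?thesis"
    then have "real t \<le> real n * ln (real k) - C * real n" by simp
    from exclusion_distance_ge_untouched[OF assms(1-3) C(1) this] t C(2) show False by simp
  qed
qed

lemma exclusion_mixing_time_le:
  assumes n: "2 \<le> n" and k: "1 \<le> k" "k \<le> n" and \<epsilon>: "0 < \<epsilon>" "\<epsilon> < 1"
  shows "exclusion_mixing_time n k \<epsilon> \<le> ereal (real n * ln (real k) + (ln (13 / \<epsilon>\<^sup>2) + 2) * real n)"
proof -
  \<comment> \<open>13 instead of 12 makes \<open>sqrt (12 * exp (- c))\<close> strictly smaller
    than \<open>\<epsilon>\<close>.\<close>
  define c where "c = ln (13 / \<epsilon>\<^sup>2)"
  have \<epsilon>2: "0 < \<epsilon>\<^sup>2" "\<epsilon>\<^sup>2 < \<epsilon>" using \<epsilon> by (auto simp: power2_eq_square)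
  have ec: "exp (- c) = \<epsilon>\<^sup>2 / 13" using \<epsilon>2 by (simp add: c_def exp_minus)
  have c: "0 \<le> c" unfolding c_def using \<epsilon>2 \<epsilon> by (intro ln_ge_zero) (simp add: le_divide_eq)
  \<comment> \<open>The extra \<open>n\<close> pays for \<open>ln n\<close> in place of
    \<open>ln k\<close> when \<open>2 * k > n\<close>; rounding up costs at most another
    \<open>n\<close>.\<close>
  define t where "t = nat \<lceil>real n * ln (real k) + (c + 1) * real n\<rceil>"
  have nk: "0 \<le> real n * ln (real k)" using k by simp
  have t: "real n * ln (real k) + (c + 1) * real n \<le> real t"
    unfolding t_def by (rule real_nat_ceiling_ge)
  have "0 \<le> real n * ln (real k) + (c + 1) * real n" using nk c by simp
  then have t': "real t \<le> real n * ln (real k) + (c + 1) * real n + 1"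
    unfolding t_def by linarith
  have cn: "0 \<le> c * real n" using c by simp
  have "0 < real t" using t nk cn n by (simp add: algebra_simps)
  moreover have "exclusion_distance n k t < \<epsilon>"
  proof (cases "2 * k \<le> n")
    case True
    have "exclusion_distance n k t \<le> 2 * exp (- c)"
      using t n by (intro exclusion_distance_le_marking n k True) (simp add: algebra_simps)
    also have "\<dots> < \<epsilon>" unfolding ec using \<epsilon> \<epsilon>2 by linarith
    finally show ?thesis .
  next
    case False
    have "ln (real n) \<le> ln (2 * real k)" using False n by (subst ln_le_cancel_iff) auto
    also have "\<dots> \<le> ln (real k) + 1" using k ln_le_minus_one[of 2] by (simp add: ln_mult)
    finally have "real n * ln (real n) \<le> real n * (ln (real k) + 1)" by (intro mult_left_mono) auto
    then have "exclusion_distance n k t \<le> sqrt (12 * exp (- c))"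
      using t c \<epsilon> \<epsilon>2 by (intro exclusion_distance_le_l2 n k) (auto simp: algebra_simps ec)
    also have "\<dots> < sqrt (\<epsilon>\<^sup>2)" using \<epsilon>2 by (intro real_sqrt_less_mono) (simp add: ec)
    also have "\<dots> = \<epsilon>" using \<epsilon> by simp
    finally show ?thesis .
  qed
  ultimately have "exclusion_mixing_time n k \<epsilon> \<le> ereal (real t)"
    unfolding exclusion_mixing_time_def by (intro INF_lower) auto
  also have "\<dots> \<le> ereal (real n * ln (real k) + (c + 2) * real n)"
    using t' n by (simp add: algebra_simps)
  finally show ?thesis by (simp add: c_def)
qed

theorem theorem1p3:
  fixes \<epsilon> :: real
  assumes "0 < \<epsilon>" and "\<epsilon> < 1"
  shows "\<exists>C::real. \<forall>n k :: nat. 2 \<le> n \<longrightarrow> 1 \<le> k \<longrightarrow> k \<le> n \<longrightarrow>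
           \<bar>exclusion_mixing_time n k \<epsilon> - ereal (real n * ln (real k))\<bar> \<le> ereal (C * real n)"
proof -
  define c where "c = ln (13 / \<epsilon>\<^sup>2) + 2"
  define d where "d = max 2 (ln (50 / (1 - \<epsilon>)))"
  have "50 * exp (- d) \<le> 50 * exp (- ln (50 / (1 - \<epsilon>)))" by (simp add: d_def)
  also have "\<dots> = 1 - \<epsilon>" using assms by (simp add: exp_minus)
  finally have d: "2 \<le> d" "50 * exp (- d) \<le> 1 - \<epsilon>" by (simp_all add: d_def)
  have "\<bar>exclusion_mixing_time n k \<epsilon> - ereal (real n * ln (real k))\<bar> \<le> ereal (max c d * real n)"
    if nk: "2 \<le> n" "1 \<le> k" "k \<le> n" for n k
  proof -
    have lower: "ereal (real n * ln (real k) - d * real n) \<le> exclusion_mixing_time n k \<epsilon>"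
      by (rule exclusion_mixing_time_ge[OF nk assms(2) d])
    have upper: "exclusion_mixing_time n k \<epsilon> \<le> ereal (real n * ln (real k) + c * real n)"
      unfolding c_def by (rule exclusion_mixing_time_le[OF nk assms])
    \<comment> \<open>Both bounds are finite, so the extended-real mixing time is a real
      number.\<close>
    obtain r where r: "exclusion_mixing_time n k \<epsilon> = ereal r"
      using lower upper by (cases "exclusion_mixing_time n k \<epsilon>") auto
    have "c * real n \<le> max c d * real n" "d * real n \<le> max c d * real n"
      by (intro mult_right_mono; simp)+
    then show ?thesis using lower upper by (simp add: r abs_le_iff)
  qed
  then show ?thesis by blast
qed

end
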